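(* Let $\Bbbk$ be a field of characteristic $0$, let $\mathbb{L}=\Bbbk(q)$, and let $n\ge 2$, $r\ge 1$ be integers. Let $\Delta_{n,r}:B_n\to B_{nr}$ be the cabling morphism, let $R_{\mathrm{bur}}$ denote the Burau representation (of $B_{nr}$ on $\mathbb{L}^{nr}$, resp. of $B_n$ on $\mathbb{L}^n$), and let $R_{\mathrm{sym}}$ denote the natural representation on $\mathbb{L}^n$ of the extended symmetric group $B_n/(P_n,P_n)$, viewed as a representation of $B_n$. Then the representation $R_{\mathrm{bur}}\circ\Delta_{n,r}$ of $B_n$ (where $R_{\mathrm{bur}}$ is the Burau representation of $B_{nr}$) is isomorphic to the direct sum of $q^{r(r-1)}R_{\mathrm{bur}}^{q^r}$ and $r-1$ copies of $q^{r^2}R_{\mathrm{sym}}^{q^{-r}}$ (where $R_{\mathrm{bur}}$ and $R_{\mathrm{sym}}$ are here the representations of $B_n$).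
   Context: $B_n$ is the braid group on $n$ strands with Artin generators $\sigma_1,\dots,\sigma_{n-1}$, and $P_n\subset B_n$ is the pure braid group; $(P_n,P_n)$ is its commutator subgroup. Cabling: $\Delta_{n,r}:B_n\to B_{nr}$ is the group morphism replacing each strand by $r$ parallel strands (without twisting). Explicitly, $\Delta_{n,r}(\sigma_i)$ is the positive braid with $r^2$ crossings exchanging the $i$-th and $(i+1)$-st blocks of $r$ consecutive strands, i.e. $\Delta_{n,r}(\sigma_i)=\prod_{a=0}^{r-1}\left(\sigma_{ri+a}\sigma_{ri+a-1}\cdots\sigma_{ri+a-r+1}\right)$, the factors being written from left to right for increasing $a$. Burau representation: for $m\ge 2$, $R_{\mathrm{bur}}:B_m\to GL_m(\mathbb{L})$ is given in block-diagonal form by $$R_{\mathrm{bur}}(\sigma_i)=qI_{i-1}\oplus\begin{pmatrix} q-q^{-1}&q\\ q^{-1}&0\end{pmatrix}\oplus qI_{m-i-1}.$$ Natural representation of the extended symmetric group: $R_{\mathrm{sym}}:B_n\to GL_n(\mathbb{L})$ (which factors through $B_n/(P_n,P_n)$) is given by $$R_{\mathrm{sym}}(\sigma_i)=I_{i-1}\oplus\begin{pmatrix}0&q\\ q&0\end{pmatrix}\oplus I_{n-i-1}.$$ For a representation $R:B_n\to GL_N(\mathbb{L})$ and $a\in\mathbb{L}^\times$, $aR$ denotes the representation with $(aR)(\sigma_i)=a\,R(\sigma_i)$ for all $i$. For $m\in\mathbb{Z}\setminus\{0\}$, $R^{q^m}$ denotes the representation obtained from $R$ by applying the field morphism $\mathbb{L}\to\mathbb{L}$,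 $q\mapsto q^m$, to the matrix entries. *)

theory Defs
  imports
    "HOL-Algebra.Sym_Groups"
    "HOL-Computational_Algebra.Polynomial_Factorial"
    "Jordan_Normal_Form.Matrix"
begin

section \<open>Braid groups\<close>

text \<open>The letter \<open>(i, True)\<close> is the Artin generator \<open>\<sigma>\<^sub>i\<close>, the letter \<open>(i, False)\<close> its inverse.
  The strands and the generators are numbered from 1.\<close>

type_synonym braid_word = "(nat \<times> bool) list"

definition braid_words :: "nat \<Rightarrow> braid_word set" where
  "braid_words n = lists ({1..<n} \<times> UNIV)"

inductive braid_eq :: "nat \<Rightarrow> braid_word \<Rightarrow> braid_word \<Rightarrow> bool" for n :: nat where
  refl: "w \<in> braid_words n \<Longrightarrow> braid_eq n w w"
| sym: "braid_eq n u v \<Longrightarrow> braid_eq n v u"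
| trans: "braid_eq n u v \<Longrightarrow> braid_eq n v w \<Longrightarrow> braid_eq n u w"
| append: "a \<in> braid_words n \<Longrightarrow> b \<in> braid_words n \<Longrightarrow> braid_eq n u v \<Longrightarrow>
    braid_eq n (a @ u @ b) (a @ v @ b)"
| cancel: "i \<in> {1..<n} \<Longrightarrow> braid_eq n [(i, s), (i, \<not> s)] []"
| far: "i \<in> {1..<n} \<Longrightarrow> j \<in> {1..<n} \<Longrightarrow> i + 2 \<le> j \<Longrightarrow>
    braid_eq n [(i, True), (j, True)] [(j, True), (i, True)]"
| braid: "i \<in> {1..<n} \<Longrightarrow> Suc i \<in> {1..<n} \<Longrightarrow>
    braid_eq n [(i, True), (Suc i, True), (i, True)] [(Suc i, True), (i, True), (Suc i, True)]"

definition braid_class :: "nat \<Rightarrow> braid_word \<Rightarrow> braid_word set" where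
  "braid_class n w = {v. braid_eq n w v}"

definition braid_group :: "nat \<Rightarrow> braid_word set monoid" where
  "braid_group n =
    \<lparr>carrier = braid_class n ` braid_words n,
     mult = (\<lambda>X Y. {w. \<exists>x\<in>X. \<exists>y\<in>Y. braid_eq n (x @ y) w}),
     one = braid_class n []\<rparr>"

definition sigma :: "nat \<Rightarrow> nat \<Rightarrow> braid_word set" where
  "sigma n i = braid_class n [(i, True)]"

fun eval_word :: "('g, 'x) monoid_scheme \<Rightarrow> (nat \<Rightarrow> 'g) \<Rightarrow> braid_word \<Rightarrow> 'g" where
  "eval_word G f [] = \<one>\<^bsub>G\<^esub>"
| "eval_word G f ((i, s) # w) = (if s then f i else inv\<^bsub>G\<^esub> (f i)) \<otimes>\<^bsub>G\<^esub> eval_word G f w"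

text \<open>The morphism \<open>\<sigma>\<^sub>i \<mapsto> f i\<close> from a braid group to \<open>G\<close>; it is meaningful if the \<open>f i\<close> satisfy the
  braid relations, see \<open>braid_lift_hom\<close> and \<open>braid_lift_sigma\<close> below.\<close>

definition braid_lift :: "('g, 'x) monoid_scheme \<Rightarrow> (nat \<Rightarrow> 'g) \<Rightarrow> braid_word set \<Rightarrow> 'g" where
  "braid_lift G f X = the_elem (eval_word G f ` X)"

lemma braid_words_simps [simp]:
  "[] \<in> braid_words n"
  "x # w \<in> braid_words n \<longleftrightarrow> fst x \<in> {1..<n} \<and> w \<in> braid_words n"
  "u @ v \<in> braid_words n \<longleftrightarrow> u \<in> braid_words n \<and> v \<in> braid_words n"
  by (cases x; auto simp: braid_words_def)+

lemma braid_eq_words: "braid_eq n u v \<Longrightarrow> u \<in> braid_words n \<and> v \<in> braid_words n"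
  by (induction rule: braid_eq.induct) auto

lemma braid_class_eq:
  assumes "u \<in> braid_words n" "v \<in> braid_words n"
  shows "braid_class n u = braid_class n v \<longleftrightarrow> braid_eq n u v"
proof
  assume "braid_class n u = braid_class n v"
  then show "braid_eq n u v"
    using braid_eq.refl[OF assms(2)] unfolding braid_class_def by auto
next
  assume uv: "braid_eq n u v"
  have "braid_eq n u w \<longleftrightarrow> braid_eq n v w" for w
    using braid_eq.trans[OF uv] braid_eq.trans[OF braid_eq.sym[OF uv]] by metis
  then show "braid_class n u = braid_class n v" by (simp add: braid_class_def)
qed

lemma braid_eq_append:
  assumes "braid_eq n u u'" "braid_eq n v v'"
  shows "braid_eq n (u @ v) (u' @ v')"
proof -
  have w: "u \<in> braid_words n" "u' \<in> braid_words n" "v \<in> braid_words n" "v' \<in> braid_words n"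
    using assms braid_eq_words by auto
  have "braid_eq n (u @ v) (u' @ v)"
    using braid_eq.append[OF _ w(3) assms(1), of "[]"] by simp
  moreover have "braid_eq n (u' @ v) (u' @ v')"
    using braid_eq.append[OF w(2) _ assms(2), of "[]"] by simp
  ultimately show ?thesis by (rule braid_eq.trans)
qed

lemma braid_group_carrier: "carrier (braid_group n) = braid_class n ` braid_words n"
  by (simp add: braid_group_def)

lemma braid_group_one: "\<one>\<^bsub>braid_group n\<^esub> = braid_class n []"
  by (simp add: braid_group_def)

lemma braid_group_mult:
  assumes "u \<in> braid_words n" "v \<in> braid_words n"
  shows "braid_class n u \<otimes>\<^bsub>braid_group n\<^esub> braid_class n v = braid_class n (u @ v)"
proof -
  have "(\<exists>x\<in>braid_class n u. \<exists>y\<in>braid_class n v. braid_eq n (x @ y) w) \<longleftrightarrow> braid_eq n (u @ v) w" for w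
  proof
    assume "\<exists>x\<in>braid_class n u. \<exists>y\<in>braid_class n v. braid_eq n (x @ y) w"
    then obtain x y where "braid_eq n u x" "braid_eq n v y" "braid_eq n (x @ y) w"
      unfolding braid_class_def by auto
    then show "braid_eq n (u @ v) w"
      using braid_eq.trans[OF braid_eq_append] by simp
  next
    assume "braid_eq n (u @ v) w"
    then show "\<exists>x\<in>braid_class n u. \<exists>y\<in>braid_class n v. braid_eq n (x @ y) w"
      unfolding braid_class_def using braid_eq.refl assms by (metis mem_Collect_eq)
  qed
  then show ?thesis by (simp add: braid_group_def braid_class_def)
qed

lemma braid_word_left_inverse:
  "w \<in> braid_words n \<Longrightarrow> \<exists>v\<in>braid_words n. braid_eq n (v @ w) []"
proof (induction w)
  case Nil
  then show ?case by (intro bexI[of _ "[]"]) (auto intro: braid_eq.refl)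
next
  case (Cons x w)
  obtain i s where x: "x = (i, s)" by force
  from Cons obtain v where v: "v \<in> braid_words n" "braid_eq n (v @ w) []" by auto
  have i: "i \<in> {1..<n}" and w: "w \<in> braid_words n" using Cons.prems x by auto
  have "braid_eq n [(i, \<not> s), (i, s)] []"
    using braid_eq.cancel[OF i, of "\<not> s"] by simp
  from braid_eq.append[OF v(1) w this]
  have "braid_eq n ((v @ [(i, \<not> s)]) @ x # w) (v @ w)" by (simp add: x)
  then show ?case using v i by (intro bexI[of _ "v @ [(i, \<not> s)]"]) (auto intro: braid_eq.trans)
qed

lemma group_braid_group: "group (braid_group n)"
proof (rule groupI)
  fix x assume "x \<in> carrier (braid_group n)"
  then obtain w where w: "w \<in> braid_words n" "x = braid_class n w"
    by (auto simp: braid_group_carrier)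
  with braid_word_left_inverse obtain v where "v \<in> braid_words n" "braid_eq n (v @ w) []" by blast
  then show "\<exists>y\<in>carrier (braid_group n). y \<otimes>\<^bsub>braid_group n\<^esub> x = \<one>\<^bsub>braid_group n\<^esub>"
    using w by (intro bexI[of _ "braid_class n v"])
      (auto simp: braid_group_carrier braid_group_one braid_group_mult braid_class_eq)
qed (auto simp: braid_group_carrier braid_group_one braid_group_mult)

lemma eval_word_closed:
  assumes "group G" "\<forall>i\<in>{1..<n}. f i \<in> carrier G" "w \<in> braid_words n"
  shows "eval_word G f w \<in> carrier G"
proof -
  interpret group G by fact
  show ?thesis using assms(2,3) by (induction w) (auto split: if_splits)
qed

lemma eval_word_append:
  assumes "group G" "\<forall>i\<in>{1..<n}. f i \<in> carrier G" "u \<in> braid_words n" "v \<in> braid_words n"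
  shows "eval_word G f (u @ v) = eval_word G f u \<otimes>\<^bsub>G\<^esub> eval_word G f v"
proof -
  interpret group G by fact
  show ?thesis using assms(2-4)
    by (induction u) (auto simp: m_assoc eval_word_closed[OF assms(1,2)])
qed

definition braid_relations :: "('g, 'x) monoid_scheme \<Rightarrow> nat \<Rightarrow> (nat \<Rightarrow> 'g) \<Rightarrow> bool" where
  "braid_relations G n f \<longleftrightarrow>
    (\<forall>i\<in>{1..<n}. f i \<in> carrier G) \<and>
    (\<forall>i\<in>{1..<n}. \<forall>j\<in>{1..<n}. i + 2 \<le> j \<longrightarrow> f i \<otimes>\<^bsub>G\<^esub> f j = f j \<otimes>\<^bsub>G\<^esub> f i) \<and>
    (\<forall>i. i \<in> {1..<n} \<and> Suc i \<in> {1..<n} \<longrightarrow>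
      f i \<otimes>\<^bsub>G\<^esub> f (Suc i) \<otimes>\<^bsub>G\<^esub> f i = f (Suc i) \<otimes>\<^bsub>G\<^esub> f i \<otimes>\<^bsub>G\<^esub> f (Suc i))"

lemma eval_word_cong:
  assumes G: "group G" and f: "braid_relations G n f" and uv: "braid_eq n u v"
  shows "eval_word G f u = eval_word G f v"
proof -
  interpret group G by fact
  have c: "\<forall>i\<in>{1..<n}. f i \<in> carrier G" using f by (auto simp: braid_relations_def)
  show ?thesis using uv
  proof (induction rule: braid_eq.induct)
    case (append a b u v)
    then have "u \<in> braid_words n" "v \<in> braid_words n" using braid_eq_words by auto
    then show ?case using append by (simp add: eval_word_append[OF G c])
  next
    case (far i j)
    then have "f i \<otimes>\<^bsub>G\<^esub> f j = f j \<otimes>\<^bsub>G\<^esub> f i"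
      using f unfolding braid_relations_def by blast
    then show ?case using far c by auto
  next
    case (braid i)
    then have "f i \<otimes>\<^bsub>G\<^esub> f (Suc i) \<otimes>\<^bsub>G\<^esub> f i = f (Suc i) \<otimes>\<^bsub>G\<^esub> f i \<otimes>\<^bsub>G\<^esub> f (Suc i)"
      using f unfolding braid_relations_def by blast
    moreover have "f i \<in> carrier G" "f (Suc i) \<in> carrier G" using braid c by auto
    ultimately show ?case by (simp add: m_assoc)
  next
    case (cancel i s)
    then show ?case using c by auto
  next
    case (sym u v)
    then show ?case by simp
  next
    case (trans u v w)
    then show ?case by simp
  qed simp
qed

lemma braid_lift_class:
  assumes "group G" "braid_relations G n f" "w \<in> braid_words n"
  shows "braid_lift G f (braid_class n w) = eval_word G f w"
proof -
  have w: "w \<in> braid_class n w" by (simp add: braid_class_def braid_eq.refl assms(3))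
  have "eval_word G f v \<in> {eval_word G f w}" if "v \<in> braid_class n w" for v
    using eval_word_cong[OF assms(1,2), of w v] that by (simp only: braid_class_def mem_Collect_eq singleton_iff)
  with w have "eval_word G f ` braid_class n w = {eval_word G f w}" by blast
  then show ?thesis by (simp only: braid_lift_def the_elem_eq)
qed

lemma braid_lift_hom:
  assumes "group G" "braid_relations G n f"
  shows "braid_lift G f \<in> hom (braid_group n) G"
proof -
  have c: "\<forall>i\<in>{1..<n}. f i \<in> carrier G" using assms by (auto simp: braid_relations_def)
  show ?thesis
    by (rule homI) (auto simp: braid_group_carrier braid_group_mult braid_lift_class[OF assms]
        eval_word_closed[OF assms(1) c] eval_word_append[OF assms(1) c])
qed

lemma braid_lift_sigma:
  assumes "group G" "braid_relations G n f" "i \<in> {1..<n}"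
  shows "braid_lift G f (sigma n i) = f i"
proof -
  interpret group G by fact
  have "f i \<in> carrier G" using assms by (auto simp: braid_relations_def)
  then show ?thesis using assms by (simp add: sigma_def braid_lift_class)
qed

text \<open>Pure braids are those whose underlying permutation of the strands is trivial.\<close>

definition braid_perm :: "nat \<Rightarrow> braid_word set \<Rightarrow> nat \<Rightarrow> nat" where
  "braid_perm n = braid_lift (sym_group n) (\<lambda>i. transpose i (Suc i))"

definition pure_braid_group :: "nat \<Rightarrow> braid_word set set" where
  "pure_braid_group n = kernel (braid_group n) (sym_group n) (braid_perm n)"

definition extended_symmetric_group :: "nat \<Rightarrow> braid_word set set monoid" where
  "extended_symmetric_group n =
    braid_group n Mod derived (braid_group n) (pure_braid_group n)"

text \<open>The word of \<open>\<Delta>(\<sigma>\<^sub>i)\<close> is the concatenation, for \<open>a = 0, \<dots>, r - 1\<close>, of the words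
  \<open>\<sigma>\<^bsub>ri+a\<^esub> \<sigma>\<^bsub>ri+a-1\<^esub> \<dots> \<sigma>\<^bsub>ri+a-r+1\<^esub>\<close>.\<close>

definition cabling :: "nat \<Rightarrow> nat \<Rightarrow> braid_word set \<Rightarrow> braid_word set" where
  "cabling n r = braid_lift (braid_group (n * r))
    (\<lambda>i. braid_class (n * r) [(r * i + a - b, True). a \<leftarrow> [0..<r], b \<leftarrow> [0..<r]])"

section \<open>Matrix representations\<close>

definition GL :: "nat \<Rightarrow> 'a::field mat monoid" where
  "GL N = units_of (ring_mat TYPE('a) N ())"

definition rep_isomorphic ::
  "('g, 'x) monoid_scheme \<Rightarrow> nat \<Rightarrow> ('g \<Rightarrow> 'a::field mat) \<Rightarrow> ('g \<Rightarrow> 'a mat) \<Rightarrow> bool" where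
  "rep_isomorphic G N R S \<longleftrightarrow>
    R \<in> hom G (GL N) \<and> S \<in> hom G (GL N) \<and>
    (\<exists>P\<in>carrier (GL N). \<forall>g\<in>carrier G. P * R g = S g * P)"

definition rep_direct_sum :: "('g \<Rightarrow> 'a::field mat) list \<Rightarrow> 'g \<Rightarrow> 'a mat" where
  "rep_direct_sum Rs g = diag_block_mat (map (\<lambda>R. R g) Rs)"

text \<open>For a representation \<open>R\<close> of degree \<open>N\<close> of the braid group on \<open>n\<close> strands, this is \<open>a R\<close>.\<close>

definition rep_scale ::
  "nat \<Rightarrow> nat \<Rightarrow> 'a::field \<Rightarrow> (braid_word set \<Rightarrow> 'a mat) \<Rightarrow> braid_word set \<Rightarrow> 'a mat" where
  "rep_scale n N a R = braid_lift (GL N) (\<lambda>i. a \<cdot>\<^sub>m R (sigma n i))"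

lemma carrier_GL:
  "A \<in> carrier (GL N) \<longleftrightarrow>
    A \<in> carrier_mat N N \<and> (\<exists>B\<in>carrier_mat N N. A * B = 1\<^sub>m N \<and> B * A = 1\<^sub>m N)"
  unfolding GL_def units_of_def Units_def ring_mat_def monoid.simps partial_object.simps ring.simps by blast

lemma mult_GL [simp]: "A \<otimes>\<^bsub>GL N\<^esub> B = A * B"
  by (simp add: GL_def units_of_def ring_mat_def)

lemma one_GL [simp]: "\<one>\<^bsub>GL N\<^esub> = 1\<^sub>m N"
  by (simp add: GL_def units_of_def ring_mat_def)

lemma group_GL: "group (GL N :: 'a::field mat monoid)"
proof -
  interpret ring "ring_mat TYPE('a) N ()" by (rule ring_mat)
  show ?thesis unfolding GL_def by (rule units_group)
qed

section \<open>The field of rational functions\<close>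

definition fract_const :: "'k::field \<Rightarrow> 'k poly fract" where
  "fract_const c = to_fract [:c:]"

definition qq :: "'k::field poly fract" where
  "qq = to_fract [:0, 1:]"

definition eval_at :: "'k::field poly fract \<Rightarrow> 'k poly \<Rightarrow> 'k poly fract" where
  "eval_at t p = poly (map_poly fract_const p) t"

text \<open>The substitution \<open>q \<mapsto> t\<close>: the value at \<open>a / b\<close> is \<open>a(t) / b(t)\<close>, for polynomials \<open>a\<close>, \<open>b\<close>
  with \<open>b \<noteq> 0\<close>. If \<open>t\<close> is transcendental, this does not depend on the choice of \<open>a\<close> and \<open>b\<close>, and
  it is a field morphism, see \<open>fract_subst_hom\<close>. By \<open>transcendental_qq_powi\<close>, this applies to
  \<open>t = q\<^sup>m\<close> with \<open>m \<noteq> 0\<close>.\<close>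

definition fract_subst :: "'k::field poly fract \<Rightarrow> 'k poly fract \<Rightarrow> 'k poly fract" where
  "fract_subst t x = (SOME y. \<exists>a b. b \<noteq> 0 \<and> x = to_fract a / to_fract b \<and>
     y = eval_at t a / eval_at t b)"

definition rep_qpow :: "int \<Rightarrow> ('g \<Rightarrow> 'k::field poly fract mat) \<Rightarrow> 'g \<Rightarrow> 'k poly fract mat" where
  "rep_qpow m R g = map_mat (fract_subst (qq powi m)) (R g)"

lemma fract_const_simps [simp]:
  "fract_const 0 = 0" "fract_const 1 = 1"
  "fract_const (a + b) = fract_const a + fract_const b"
  "fract_const (a * b) = fract_const a * fract_const b"
  "fract_const a = 0 \<longleftrightarrow> a = 0"
proof -
  show "fract_const 1 = 1" by (simp add: fract_const_def flip: one_pCons)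
  show "fract_const (a + b) = fract_const a + fract_const b"
    unfolding fract_const_def to_fract_add[symmetric] by simp
  show "fract_const (a * b) = fract_const a * fract_const b"
    unfolding fract_const_def to_fract_mult[symmetric] by simp
qed (simp_all add: fract_const_def)

lemma eval_at_0 [simp]: "eval_at t 0 = 0"
  by (simp add: eval_at_def)

lemma eval_at_1 [simp]: "eval_at t 1 = 1"
  by (simp add: eval_at_def)

lemma eval_at_pCons [simp]: "eval_at t (pCons c p) = fract_const c + t * eval_at t p"
  by (simp add: eval_at_def map_poly_pCons)

lemma eval_at_add: "eval_at t (p + q) = eval_at t p + eval_at t q"
proof -
  have "map_poly fract_const (p + q) = map_poly fract_const p + map_poly fract_const q"
    by (rule poly_eqI) (simp add: coeff_map_poly)
  then show ?thesis by (simp add: eval_at_def)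
qed

lemma eval_at_smult: "eval_at t (Polynomial.smult c p) = fract_const c * eval_at t p"
  by (induction p) (simp_all add: algebra_simps)

lemma eval_at_mult: "eval_at t (p * q) = eval_at t p * eval_at t q"
  by (induction p) (simp_all add: mult_pCons_left eval_at_add eval_at_smult algebra_simps)

definition transcendental :: "'k::field poly fract \<Rightarrow> bool" where
  "transcendental t \<longleftrightarrow> (\<forall>p. eval_at t p = 0 \<longrightarrow> p = 0)"

lemma fract_subst_eq:
  assumes t: "transcendental t" and b: "b \<noteq> 0"
  shows "fract_subst t (to_fract a / to_fract b) = eval_at t a / eval_at t b"
  unfolding fract_subst_def
proof (rule some_equality)
  fix y assume "\<exists>a' b'. b' \<noteq> 0 \<and> to_fract a / to_fract b = to_fract a' / to_fract b' \<and>
    y = eval_at t a' / eval_at t b'"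
  then obtain a' b' where *: "b' \<noteq> 0" "to_fract a / to_fract b = to_fract a' / to_fract b'"
    "y = eval_at t a' / eval_at t b'" by blast
  then have "to_fract (a * b') = to_fract (a' * b)" using b by (simp add: frac_eq_eq)
  then have "eval_at t (a * b') = eval_at t (a' * b)" by (simp only: to_fract_eq_iff)
  moreover have "eval_at t b \<noteq> 0" "eval_at t b' \<noteq> 0" using t b * by (auto simp: transcendental_def)
  ultimately show "y = eval_at t a / eval_at t b" using * by (simp add: eval_at_mult frac_eq_eq)
qed (use b in blast)

lemma fract_cases:
  fixes x :: "'k::field poly fract"
  obtains a b where "b \<noteq> 0" "x = to_fract a / to_fract b"
  by (cases x) (auto simp: Fract_conv_to_fract)

lemma fract_subst_hom:
  assumes t: "transcendental t"
  shows "fract_subst t (fract_const c) = fract_const c"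
    and "fract_subst t qq = t"
    and "fract_subst t (x + y) = fract_subst t x + fract_subst t y"
    and "fract_subst t (x * y) = fract_subst t x * fract_subst t y"
proof -
  have nz: "b \<noteq> 0 \<Longrightarrow> eval_at t b \<noteq> 0" for b using t by (auto simp: transcendental_def)
  have 1: "fract_subst t (to_fract a) = eval_at t a" for a
    using fract_subst_eq[OF t, of 1 a] by simp
  show "fract_subst t (fract_const c) = fract_const c"
    using 1[of "[:c:]"] by (simp add: fract_const_def[of c, symmetric])
  show "fract_subst t qq = t" using 1[of "[:0, 1:]"] by (simp add: qq_def)
  obtain a b where x: "b \<noteq> 0" "x = to_fract a / to_fract b" by (rule fract_cases)
  obtain c d where y: "d \<noteq> 0" "y = to_fract c / to_fract d" by (rule fract_cases)
  have "x + y = to_fract (a * d + c * b) / to_fract (b * d)" using x y by (simp add: add_frac_eq)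
  then show "fract_subst t (x + y) = fract_subst t x + fract_subst t y"
    using x y nz by (simp add: fract_subst_eq[OF t] eval_at_mult eval_at_add add_frac_eq
        del: to_fract_add to_fract_mult)
  have "x * y = to_fract (a * c) / to_fract (b * d)" using x y by simp
  then show "fract_subst t (x * y) = fract_subst t x * fract_subst t y"
    using x y nz by (simp add: fract_subst_eq[OF t] eval_at_mult
        del: to_fract_add to_fract_mult)
qed

lemma qq_nonzero [simp]: "qq \<noteq> 0"
  by (simp add: qq_def)

lemma transcendental_qq_power:
  assumes "k > 0"
  shows "transcendental (qq ^ k :: 'k::field poly fract)"
proof -
  have pow: "to_fract ([:0, 1:] ^ k) = qq ^ k" for k by (induction k) (simp_all only: power_0 power_Suc to_fract_1 to_fract_mult qq_def)
  have "eval_at (qq ^ k) p = to_fract (pcompose p (monom 1 k))" for p :: "'k poly"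
    by (induction p) (simp_all add: pcompose_pCons fract_const_def monom_altdef pow)
  then show ?thesis
    using assms by (auto simp: transcendental_def pcompose_eq_0_iff degree_monom_eq)
qed

lemma transcendental_inverse:
  assumes "transcendental (inverse t)" "t \<noteq> 0"
  shows "transcendental t"
  unfolding transcendental_def
proof (intro allI impI)
  fix p assume p: "eval_at t p = 0"
  have "degree (map_poly fract_const p) = degree p" by (rule degree_map_poly) simp
  then have "map_poly fract_const (reflect_poly p) = reflect_poly (map_poly fract_const p)"
    by (intro poly_eqI) (simp add: coeff_map_poly coeff_reflect_poly)
  then have "eval_at (inverse t) (reflect_poly p) = 0"
    using p assms(2) by (simp add: eval_at_def poly_reflect_poly_nz)
  then show "p = 0" using assms(1) by (auto simp: transcendental_def)
qed

lemma transcendental_qq_powi: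
  assumes "m \<noteq> 0"
  shows "transcendental (qq powi m)"
proof (cases "m > 0")
  case True
  then show ?thesis using transcendental_qq_power[of "nat m"] by (simp add: power_int_def)
next
  case False
  then have "transcendental (inverse (qq powi m))"
    using assms transcendental_qq_power[of "nat (- m)"] by (simp add: power_int_def power_inverse)
  then show ?thesis by (rule transcendental_inverse) simp
qed


section \<open>The Burau representation and the natural representation\<close>

definition local_mat :: "nat \<Rightarrow> nat \<Rightarrow> 'a::field \<Rightarrow> 'a mat \<Rightarrow> 'a mat" where
  "local_mat m i e B = diag_block_mat [e \<cdot>\<^sub>m 1\<^sub>m (i - 1), B, e \<cdot>\<^sub>m 1\<^sub>m (m - i - 1)]"

definition burau_mat :: "nat \<Rightarrow> nat \<Rightarrow> 'k::field poly fract mat" where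
  "burau_mat m i =
    local_mat m i qq (mat_of_rows_list 2 [[qq - inverse qq, qq], [inverse qq, 0]])"

definition burau_rep :: "nat \<Rightarrow> braid_word set \<Rightarrow> 'k::field poly fract mat" where
  "burau_rep m = braid_lift (GL m) (burau_mat m)"

definition sym_mat :: "nat \<Rightarrow> nat \<Rightarrow> 'k::field poly fract mat" where
  "sym_mat n i = local_mat n i 1 (mat_of_rows_list 2 [[0, qq], [qq, 0]])"

definition sym_rep :: "nat \<Rightarrow> braid_word set \<Rightarrow> 'k::field poly fract mat" where
  "sym_rep n = braid_lift (GL n) (sym_mat n)"

lemma local_mat_carrier:
  assumes "i \<in> {1..<m}" "B \<in> carrier_mat 2 2"
  shows "local_mat m i e B \<in> carrier_mat m m"
  using assms by (auto simp: local_mat_def Let_def)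

lemma local_mat_index:
  assumes "i \<in> {1..<m}" "j < m" "k < m"
  shows "local_mat m i e (mat_of_rows_list 2 [[a, b], [c, d]]) $$ (j, k) =
    (if j = i - 1 then if k = i - 1 then a else if k = i then b else 0
     else if j = i then if k = i - 1 then c else if k = i then d else 0
     else if j = k then e else 0)"
proof -
  define B where "B = mat_of_rows_list 2 [[a, b], [c, d]]"
  have B: "dim_row B = 2" "dim_col B = 2"
    "B $$ (0, 0) = a" "B $$ (0, 1) = b" "B $$ (1, 0) = c" "B $$ (1, 1) = d"
    by (simp_all add: B_def mat_of_rows_list_def)
  obtain p where p: "i = Suc p" using assms(1) by (cases i) auto
  have "local_mat m i e B $$ (j, k) =
    (if j < p then if j = k then e else 0
     else if j < p + 2 then if p \<le> k \<and> k < p + 2 then B $$ (j - p, k - p) else 0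
     else if j = k then e else 0)"
    using assms by (simp add: local_mat_def p B(1,2)) auto
  moreover have "j < p \<or> j = p \<or> j = Suc p \<or> p + 2 \<le> j" by linarith
  moreover have "k < p \<or> k = p \<or> k = Suc p \<or> p + 2 \<le> k" by linarith
  ultimately show ?thesis
    unfolding B_def[symmetric] p using B(3-6) by (elim disjE) simp_all
qed

lemma local_mat_mult_vec:
  assumes i: "i \<in> {1..<m}" and v: "v \<in> carrier_vec m"
  shows "local_mat m i e (mat_of_rows_list 2 [[a, b], [c, d]]) *\<^sub>v v =
    vec m (\<lambda>j. if j = i - 1 then a * v $ (i - 1) + b * v $ i
               else if j = i then c * v $ (i - 1) + d * v $ i else e * v $ j)"
    (is "?M *\<^sub>v v = _")
proof (rule eq_vecI)
  have M: "?M \<in> carrier_mat m m" using i by (intro local_mat_carrier) (auto simp: mat_of_rows_list_def)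
  then show "dim_vec (?M *\<^sub>v v) = dim_vec (vec m (\<lambda>j. if j = i - 1 then a * v $ (i - 1) + b * v $ i
               else if j = i then c * v $ (i - 1) + d * v $ i else e * v $ j))" by auto
  fix j assume "j < dim_vec (vec m (\<lambda>j. if j = i - 1 then a * v $ (i - 1) + b * v $ i
               else if j = i then c * v $ (i - 1) + d * v $ i else e * v $ j))"
  then have j: "j < m" by simp
  have "(?M *\<^sub>v v) $ j = (\<Sum>k<m. ?M $$ (j, k) * v $ k)"
    using M v j by (auto simp: scalar_prod_def atLeast0LessThan intro!: sum.cong)
  also have "\<dots> = (\<Sum>k<m. if k = i - 1 then if j = i - 1 then a * v $ k else if j = i then c * v $ k else 0 else 0)
      + (\<Sum>k<m. if k = i then if j = i - 1 then b * v $ k else if j = i then d * v $ k else 0 else 0)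
      + (\<Sum>k<m. if k = j then if j \<noteq> i - 1 \<and> j \<noteq> i then e * v $ k else 0 else 0)"
    unfolding sum.distrib[symmetric] using i j
    by (intro sum.cong) (auto simp: local_mat_index)
  also have "\<dots> = vec m (\<lambda>j. if j = i - 1 then a * v $ (i - 1) + b * v $ i
               else if j = i then c * v $ (i - 1) + d * v $ i else e * v $ j) $ j"
    using i j by simp arith
  finally show "(?M *\<^sub>v v) $ j = vec m (\<lambda>j. if j = i - 1 then a * v $ (i - 1) + b * v $ i
               else if j = i then c * v $ (i - 1) + d * v $ i else e * v $ j) $ j" .
qed

lemma mat_eq_by_vec:
  assumes "A \<in> carrier_mat m m" "B \<in> carrier_mat m m"
    "\<And>v. v \<in> carrier_vec m \<Longrightarrow> A *\<^sub>v v = B *\<^sub>v (v :: 'a::field vec)"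
  shows "A = B"
proof (rule eq_matI)
  fix i j assume "i < dim_row B" "j < dim_col B"
  then have ij: "i < m" "j < m" using assms by auto
  have col: "(C *\<^sub>v unit_vec m j) $ i = C $$ (i, j)" if "C \<in> carrier_mat m m" for C :: "'a mat"
    using that ij by (simp add: row_carrier_vec)
  show "A $$ (i, j) = B $$ (i, j)"
    using col[OF assms(1)] col[OF assms(2)] assms(3)[of "unit_vec m j"] by simp
qed (use assms in auto)

abbreviation mat2 :: "'a \<Rightarrow> 'a \<Rightarrow> 'a \<Rightarrow> 'a \<Rightarrow> 'a mat" where
  "mat2 a b c d \<equiv> mat_of_rows_list 2 [[a, b], [c, d]]"

lemma local_mat_carrier2: "i \<in> {1..<m} \<Longrightarrow> local_mat m i e (mat2 a b c d) \<in> carrier_mat m m"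
  by (intro local_mat_carrier) (auto simp: mat_of_rows_list_def)

lemma local_mat_mult:
  assumes i: "i \<in> {1..<m}"
  shows "local_mat m i e (mat2 a b c d) * local_mat m i e' (mat2 a' b' c' d') =
    local_mat m i (e * e') (mat2 (a * a' + b * c') (a * b' + b * d') (c * a' + d * c') (c * b' + d * d'))"
    (is "?M * ?N = ?L")
proof (rule mat_eq_by_vec[of _ m])
  note [simp] = local_mat_carrier2[OF i] local_mat_mult_vec[OF i]
  show "?M * ?N \<in> carrier_mat m m" "?L \<in> carrier_mat m m" by (auto intro!: mult_carrier_mat[of _ m m])
  fix v :: "'a vec" assume v: "v \<in> carrier_vec m"
  have "?M * ?N *\<^sub>v v = ?M *\<^sub>v (?N *\<^sub>v v)" by (rule assoc_mult_mat_vec[of _ m m _ m]) (use v in auto)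
  also have "\<dots> = ?L *\<^sub>v v" using i v by (auto simp: algebra_simps intro!: eq_vecI)
  finally show "?M * ?N *\<^sub>v v = ?L *\<^sub>v v" .
qed

lemma local_mat_one:
  assumes "i \<in> {1..<m}"
  shows "local_mat m i 1 (mat2 1 0 0 1) = 1\<^sub>m m"
  by (rule eq_matI) (use assms local_mat_carrier2[OF assms, of 1 1 0 0 1] in \<open>auto simp: local_mat_index\<close>)

lemma local_mat_GL:
  assumes i: "i \<in> {1..<m}" and e: "e \<noteq> 0" and det: "a * d - b * c \<noteq> 0"
  shows "local_mat m i e (mat2 a b c d) \<in> carrier (GL m)"
proof -
  define D where "D = a * d - b * c"
  have D: "a * d = D + b * c" "D \<noteq> 0" using det by (auto simp: D_def)
  have "a * (d / D) + b * (- c / D) = 1" "a * (- b / D) + b * (a / D) = 0"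
    "c * (d / D) + d * (- c / D) = 0" "c * (- b / D) + d * (a / D) = 1"
    "d / D * a + - b / D * c = 1" "d / D * b + - b / D * d = 0"
    "- c / D * a + a / D * c = 0" "- c / D * b + a / D * d = 1"
    using D by (simp_all add: field_simps)
  moreover have "e * inverse e = 1" "inverse e * e = 1" using e by simp_all
  ultimately show ?thesis
    unfolding carrier_GL using i
    by (intro conjI bexI[of _ "local_mat m i (inverse e) (mat2 (d / D) (- b / D) (- c / D) (a / D))"])
      (simp_all only: local_mat_mult local_mat_carrier2 local_mat_one right_inverse left_inverse)
qed

lemma local_mat_far:
  assumes i: "i \<in> {1..<m}" and j: "j \<in> {1..<m}" and "i + 2 \<le> j"
  shows "local_mat m i e (mat2 a b c d) * local_mat m j e (mat2 a b c d) =
    local_mat m j e (mat2 a b c d) * local_mat m i e (mat2 a b c d)"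
    (is "?M * ?N = _")
proof (rule mat_eq_by_vec[of _ m])
  note [simp] = local_mat_carrier2[OF i] local_mat_mult_vec[OF i]
    local_mat_carrier2[OF j] local_mat_mult_vec[OF j]
  show "?M * ?N \<in> carrier_mat m m" "?N * ?M \<in> carrier_mat m m" by (auto intro!: mult_carrier_mat[of _ m m])
  fix v :: "'a vec" assume v: "v \<in> carrier_vec m"
  have "?M * ?N *\<^sub>v v = ?M *\<^sub>v (?N *\<^sub>v v)" by (rule assoc_mult_mat_vec[of _ m m _ m]) (use v in auto)
  also have "\<dots> = ?N *\<^sub>v (?M *\<^sub>v v)"
    using assms v by (auto simp: algebra_simps intro!: eq_vecI)
  also have "\<dots> = ?N * ?M *\<^sub>v v" by (rule assoc_mult_mat_vec[of _ m m _ m, symmetric]) (use v in auto)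
  finally show "?M * ?N *\<^sub>v v = ?N * ?M *\<^sub>v v" .
qed

lemma mult_mat_vec3:
  assumes "A \<in> carrier_mat m m" "B \<in> carrier_mat m m" "C \<in> carrier_mat m m" "v \<in> carrier_vec m"
  shows "A * B * C *\<^sub>v v = A *\<^sub>v (B *\<^sub>v (C *\<^sub>v (v :: 'a::field vec)))"
proof -
  have "A * B \<in> carrier_mat m m" "C *\<^sub>v v \<in> carrier_vec m" using assms by auto
  then show ?thesis
    using assms assoc_mult_mat_vec[of "A * B" m m C m v] assoc_mult_mat_vec[of A m m B m "C *\<^sub>v v"]
    by simp
qed

lemma local_mat_braid:
  assumes i: "i \<in> {1..<m}" and j: "Suc i \<in> {1..<m}"
    and rel: "a * a * e + a * b * c = a * e * e"
  shows "local_mat m i e (mat2 a b c 0) * local_mat m (Suc i) e (mat2 a b c 0) * local_mat m i e (mat2 a b c 0) =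
    local_mat m (Suc i) e (mat2 a b c 0) * local_mat m i e (mat2 a b c 0) * local_mat m (Suc i) e (mat2 a b c 0)"
    (is "?M * ?N * _ = _")
proof (rule mat_eq_by_vec[of _ m])
  note [simp] = local_mat_carrier2[OF i] local_mat_mult_vec[OF i]
    local_mat_carrier2[OF j] local_mat_mult_vec[OF j]
  show "?M * ?N * ?M \<in> carrier_mat m m" "?N * ?M * ?N \<in> carrier_mat m m"
    by (auto intro!: mult_carrier_mat[of _ m m])
  have *: "a * (a * (e * x)) + a * (b * (c * x)) = a * (e * (e * x))" for x
    using arg_cong[OF rel, of "\<lambda>y. y * x"] by (simp add: algebra_simps)
  fix v :: "'a vec" assume v: "v \<in> carrier_vec m"
  have "?M * ?N * ?M *\<^sub>v v = ?M *\<^sub>v (?N *\<^sub>v (?M *\<^sub>v v))"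
    by (rule mult_mat_vec3) (use v in auto)
  also have "\<dots> = ?N *\<^sub>v (?M *\<^sub>v (?N *\<^sub>v v))"
    using i j v *[of "v $ (i - 1)"] by (auto simp: algebra_simps intro!: eq_vecI)
  also have "\<dots> = ?N * ?M * ?N *\<^sub>v v"
    by (rule mult_mat_vec3[symmetric]) (use v in auto)
  finally show "?M * ?N * ?M *\<^sub>v v = ?N * ?M * ?N *\<^sub>v v" .
qed

lemma braid_relations_local_mat:
  assumes "e \<noteq> 0" "b * c \<noteq> 0" "a * a * e + a * b * c = a * e * e"
  shows "braid_relations (GL m) m (\<lambda>i. local_mat m i e (mat2 a b c 0))"
  unfolding braid_relations_def
  using assms by (auto intro!: local_mat_GL local_mat_far local_mat_braid)

lemma braid_relations_burau: "braid_relations (GL m) m (burau_mat m)"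
  using braid_relations_local_mat[of qq qq "inverse qq" "qq - inverse qq" m]
  by (simp add: burau_mat_def[abs_def] algebra_simps)

lemma braid_relations_sym: "braid_relations (GL n) n (sym_mat n)"
  using braid_relations_local_mat[of 1 qq qq 0 n]
  by (simp add: sym_mat_def[abs_def])

lemma burau_rep:
  "burau_rep m \<in> hom (braid_group m) (GL m)"
  "i \<in> {1..<m} \<Longrightarrow> burau_rep m (sigma m i) = burau_mat m i"
  unfolding burau_rep_def
  by (auto intro!: braid_lift_hom braid_lift_sigma group_GL braid_relations_burau)

lemma sym_rep:
  "sym_rep n \<in> hom (braid_group n) (GL n)"
  "i \<in> {1..<n} \<Longrightarrow> sym_rep n (sigma n i) = sym_mat n i"
  unfolding sym_rep_def
  by (auto intro!: braid_lift_hom braid_lift_sigma group_GL braid_relations_sym)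

lemma braid_relations_perm: "braid_relations (sym_group n) n (\<lambda>i. transpose i (Suc i))"
  unfolding braid_relations_def
  by (auto simp: sym_group_def fun_eq_iff transpose_def intro!: permutes_swap_id)

text \<open>\<open>sym_rep\<close> factors through the quotient of the braid group by the commutator subgroup of the
  pure braid group.\<close>

definition permutes_basis :: "nat \<Rightarrow> (nat \<Rightarrow> nat) \<Rightarrow> 'a::field mat \<Rightarrow> bool" where
  "permutes_basis n p A \<longleftrightarrow>
    A \<in> carrier_mat n n \<and> (\<forall>j<n. \<forall>k<n. A $$ (j, k) \<noteq> 0 \<longrightarrow> Suc j = p (Suc k))"

lemma permutes_basis_mult:
  assumes A: "permutes_basis n p A" and B: "permutes_basis n r B"
  shows "permutes_basis n (p \<circ> r) (A * B)"
  unfolding permutes_basis_def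
proof (intro conjI allI impI)
  show "A * B \<in> carrier_mat n n" using A B by (auto simp: permutes_basis_def)
  fix j k assume jk: "j < n" "k < n" "(A * B) $$ (j, k) \<noteq> 0"
  then have "(\<Sum>l = 0..<n. A $$ (j, l) * B $$ (l, k)) \<noteq> 0"
    using A B by (auto simp: permutes_basis_def scalar_prod_def)
  then obtain l where "l \<in> {0..<n}" "A $$ (j, l) * B $$ (l, k) \<noteq> 0"
    by (rule sum.not_neutral_contains_not_neutral)
  then show "Suc j = (p \<circ> r) (Suc k)" using A B jk by (auto simp: permutes_basis_def)
qed

lemma permutes_basis_local_mat:
  assumes i: "i \<in> {1..<n}"
  shows "permutes_basis n (transpose i (Suc i)) (local_mat n i e (mat2 0 b c 0))"
  using i local_mat_carrier2[OF i, of e 0 b c 0]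
  by (auto simp: permutes_basis_def local_mat_index transpose_def)

lemma permutes_basis_sym_mat:
  assumes i: "i \<in> {1..<n}"
  shows "permutes_basis n (transpose i (Suc i)) (sym_mat n i)"
    "permutes_basis n (inv\<^bsub>sym_group n\<^esub> (transpose i (Suc i)))
      (inv\<^bsub>GL n\<^esub> (sym_mat n i :: 'k::field poly fract mat))"
proof -
  show "permutes_basis n (transpose i (Suc i)) (sym_mat n i)"
    unfolding sym_mat_def using i by (rule permutes_basis_local_mat)
  let ?N = "local_mat n i 1 (mat2 0 (inverse qq) (inverse qq) 0) :: 'k poly fract mat"
  have "inv\<^bsub>GL n\<^esub> (sym_mat n i) = ?N"
  proof (rule group.inv_equality[OF group_GL])
    show "?N \<otimes>\<^bsub>GL n\<^esub> sym_mat n i = \<one>\<^bsub>GL n\<^esub>"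
      using i by (simp add: sym_mat_def local_mat_mult local_mat_one del: One_nat_def)
  qed (use i in \<open>auto simp: sym_mat_def intro!: local_mat_GL\<close>)
  moreover have "inv\<^bsub>sym_group n\<^esub> (transpose i (Suc i)) = transpose i (Suc i)"
    by (rule group.inv_equality[OF sym_group_is_group])
      (use i in \<open>auto simp: sym_group_def intro!: permutes_swap_id\<close>)
  ultimately show "permutes_basis n (inv\<^bsub>sym_group n\<^esub> (transpose i (Suc i)))
      (inv\<^bsub>GL n\<^esub> (sym_mat n i :: 'k poly fract mat))"
    using permutes_basis_local_mat[OF i] by simp
qed

lemma permutes_basis_sym_rep:
  assumes "g \<in> carrier (braid_group n)"
  shows "permutes_basis n (braid_perm n g) (sym_rep n g)"
proof -
  obtain w where w: "w \<in> braid_words n" "g = braid_class n w"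
    using assms by (auto simp: braid_group_carrier)
  have "permutes_basis n (eval_word (sym_group n) (\<lambda>i. transpose i (Suc i)) w)
      (eval_word (GL n) (sym_mat n) w)"
    using w(1)
  proof (induction w)
    case Nil
    then show ?case by (auto simp: permutes_basis_def sym_group_def)
  next
    case (Cons x w)
    obtain i s where x: "x = (i, s)" by force
    have m: "p \<otimes>\<^bsub>sym_group n\<^esub> r = p \<circ> r" for p r by (simp add: sym_group_def)
    have i: "i \<in> {1..<n}" and w: "w \<in> braid_words n" using Cons.prems x by auto
    show ?case
      unfolding x eval_word.simps m mult_GL
      by (rule permutes_basis_mult[OF _ Cons.IH[OF w]])
        (cases s; simp only: if_True if_False permutes_basis_sym_mat[OF i])
  qed
  then show ?thesis
    using w by (simp add: braid_perm_def sym_rep_def braid_lift_class braid_relations_perm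
        braid_relations_sym group_GL sym_group_is_group)
qed

lemma permutes_basis_id_commute:
  assumes A: "permutes_basis n id A" and B: "permutes_basis n id B"
  shows "A * B = B * A"
proof -
  have *: "(A * B) $$ (j, k) = (if j = k then A $$ (j, j) * B $$ (j, j) else 0)"
    if A: "permutes_basis n id A" and B: "permutes_basis n id B" and jk: "j < n" "k < n"
    for A B :: "'a mat" and j k
  proof (cases "j = k")
    case True
    have "(A * B) $$ (j, k) = (\<Sum>l = 0..<n. A $$ (j, l) * B $$ (l, k))"
      using A B jk by (auto simp: permutes_basis_def scalar_prod_def)
    also have "\<dots> = (\<Sum>l = 0..<n. if l = j then A $$ (j, l) * B $$ (l, k) else 0)"
      using A jk by (intro sum.cong) (auto simp: permutes_basis_def)
    finally show ?thesis using True jk by simp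
  next
    case False
    then show ?thesis
      using permutes_basis_mult[OF A B] jk by (auto simp: permutes_basis_def)
  qed
  show ?thesis
    by (rule eq_matI) (use A B in \<open>auto simp: * permutes_basis_def simp del: index_mult_mat(1)\<close>)
qed

lemma sym_rep_derived:
  assumes "g \<in> derived (braid_group n) (pure_braid_group n)"
  shows "sym_rep n g = (1\<^sub>m n :: 'k::field poly fract mat)"
proof -
  interpret B: group "braid_group n" by (rule group_braid_group)
  interpret L: group "GL n :: 'k poly fract mat monoid" by (rule group_GL)
  interpret h: group_hom "braid_group n" "GL n :: 'k poly fract mat monoid" "sym_rep n"
    by unfold_locales (rule sym_rep)
  have pure: "x \<in> carrier (braid_group n)" "permutes_basis n id (sym_rep n x :: 'k poly fract mat)"
    if "x \<in> pure_braid_group n" for x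
    using that permutes_basis_sym_rep[of x n]
    by (auto simp: pure_braid_group_def kernel_def sym_group_def)
  have "derived (braid_group n) (pure_braid_group n) \<subseteq> 
      kernel (braid_group n) (GL n :: 'k poly fract mat monoid) (sym_rep n)"
    unfolding derived_def
  proof (rule B.generate_subgroup_incl[OF _ h.subgroup_kernel], safe)
    fix x y assume xy: "x \<in> pure_braid_group n" "y \<in> pure_braid_group n"
    note p = pure[OF xy(1)] pure[OF xy(2)]
    let ?x = "sym_rep n x :: 'k poly fract mat" and ?y = "sym_rep n y :: 'k poly fract mat"
    have c: "?x \<in> carrier (GL n)" "?y \<in> carrier (GL n)" using p by auto
    have "?x \<otimes>\<^bsub>GL n\<^esub> ?y = ?y \<otimes>\<^bsub>GL n\<^esub> ?x"
      using permutes_basis_id_commute[OF p(2,4)] by simp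
    then have "?x \<otimes>\<^bsub>GL n\<^esub> ?y \<otimes>\<^bsub>GL n\<^esub> inv\<^bsub>GL n\<^esub> ?x \<otimes>\<^bsub>GL n\<^esub> inv\<^bsub>GL n\<^esub> ?y = \<one>\<^bsub>GL n\<^esub>"
      using c by (simp add: L.m_assoc del: mult_GL one_GL)
    then show "x \<otimes>\<^bsub>braid_group n\<^esub> y \<otimes>\<^bsub>braid_group n\<^esub> inv\<^bsub>braid_group n\<^esub> x
      \<otimes>\<^bsub>braid_group n\<^esub> inv\<^bsub>braid_group n\<^esub> y
      \<in> kernel (braid_group n) (GL n :: 'k poly fract mat monoid) (sym_rep n)"
      using p by (simp add: kernel_def h.hom_mult h.hom_inv del: mult_GL one_GL)
  qed
  then show ?thesis using assms by (auto simp: kernel_def)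
qed

lemma sym_rep_factors:
  obtains \<rho> where
    "\<rho> \<in> hom (extended_symmetric_group n) (GL n :: 'k::field poly fract mat monoid)"
    "\<And>g. g \<in> carrier (braid_group n) \<Longrightarrow>
       \<rho> (derived (braid_group n) (pure_braid_group n) #>\<^bsub>braid_group n\<^esub> g) = sym_rep n g"
proof -
  interpret h: group_hom "braid_group n" "GL n :: 'k poly fract mat monoid" "sym_rep n"
    by (simp add: group_hom_def group_hom_axioms_def group_braid_group group_GL sym_rep)
  interpret p: group_hom "braid_group n" "sym_group n" "braid_perm n"
    by (simp add: group_hom_def group_hom_axioms_def group_braid_group sym_group_is_group
        braid_perm_def braid_lift_hom braid_relations_perm)
  have N: "derived (braid_group n) (pure_braid_group n) \<lhd> braid_group n"
    unfolding pure_braid_group_def by (rule group.derived_is_normal[OF group_braid_group p.normal_kernel])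
  have "derived (braid_group n) (pure_braid_group n) \<subseteq>
      kernel (braid_group n) (GL n :: 'k poly fract mat monoid) (sym_rep n)"
    using sym_rep_derived group.derived_in_carrier[OF group_braid_group, of "pure_braid_group n" n]
    by (auto simp: kernel_def pure_braid_group_def)
  from h.FactGroup_universal_kernel[OF N this] that show thesis
    unfolding extended_symmetric_group_def by blast
qed

end

theory Submission
  imports Defs "Jordan_Normal_Form.Determinant"
begin

text \<open>The cabled generator \<open>\<Delta>(\<sigma>\<^sub>i)\<close> acts on the column vectors of \<open>\<bbbL>\<^sup>n\<^sup>r\<close>, cut into \<open>n\<close> blocks of
  length \<open>r\<close>, by a simple formula (\<open>burau_cabling_sigma\<close>): it sends the blocks \<open>X\<close>, \<open>Y\<close> number
  \<open>i\<close>, \<open>i + 1\<close> to \<open>q\<^bsup>r\<^sup>2\<^esup> Y + (q - q\<^sup>-\<^sup>1) q\<^bsup>r\<^sup>2-1\<^esup> s(X) D\<close> and \<open>q\<^bsup>r\<^sup>2-2r\<^esup> X\<close>, and multiplies the others by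
  \<open>q\<^bsup>r\<^sup>2\<^esup>\<close>. Here \<open>s(X)\<close> is the sum of the entries of \<open>X\<close>, and \<open>D\<close> is the vector of the \<open>q\<^bsup>-2j\<^esup>\<close>,
  \<open>0 \<le> j < r\<close>. The same functional \<open>s\<close> and the same vector \<open>D\<close> occur for every \<open>i\<close>, so everything
  follows from a decomposition of a single block \<open>\<bbbL>\<^sup>r = \<bbbL> D \<oplus> ker s\<close>; the sum is direct because
  \<open>s(D) = (1 - q\<^bsup>-2r\<^esup>) / (1 - q\<^sup>-\<^sup>2)\<close> is not zero.

  On the multiples of \<open>D\<close>, the coefficient is \<open>(q - q\<^sup>-\<^sup>1) q\<^bsup>r\<^sup>2-1\<^esup> s(D) = q\<^bsup>r(r-1)\<^esup> (q\<^sup>r - q\<^sup>-\<^sup>r)\<close>, and the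
  formula becomes the one of \<open>q\<^bsup>r(r-1)\<^esup> R\<^sub>b\<^sub>u\<^sub>r\<close> at \<open>q\<^sup>r\<close>. On \<open>ker s\<close>, which has dimension \<open>r - 1\<close>, the
  two blocks are exchanged with the coefficients \<open>q\<^bsup>r\<^sup>2\<^esup>\<close> and \<open>q\<^bsup>r\<^sup>2-2r\<^esup>\<close>. Rescaling the block number \<open>k\<close> by
  \<open>q\<^bsup>rk\<^esup>\<close> turns both into \<open>q\<^bsup>r\<^sup>2-r\<^esup>\<close>, which gives \<open>q\<^bsup>r\<^sup>2\<^esup> R\<^sub>s\<^sub>y\<^sub>m\<close> at \<open>q\<^sup>-\<^sup>r\<close>. In coordinates, the rows of
  the intertwining matrix \<open>basis_change\<close> are the functional \<open>s\<close> and functionals that vanish on \<open>D\<close>;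
  \<open>basis_change_GL\<close> and \<open>basis_change_intertwines_sigma\<close> say that it is invertible and that it
  intertwines the generators. By \<open>intertwine_from_generators\<close>, this is enough.

  It has to be proved as well that both sides are representations. For the left-hand side, this amounts to
  the braid relations for the cabled generators in the braid group on \<open>n r\<close> strands
  (\<open>braid_relations_cabling\<close>), which are derived from the Artin relations by moving letters
  through grid-shaped words (\<open>grid_shift_word\<close>, \<open>grid_merge\<close>).\<close>

section \<open>Grid-shaped words\<close>

text \<open>The word \<open>\<sigma>\<^sub>s \<sigma>\<^bsub>s-1\<^esub> \<dots> \<sigma>\<^bsub>s-L+1\<^esub>\<close>: one strand crosses \<open>L\<close> others.\<close>

definition run :: "nat \<Rightarrow> nat \<Rightarrow> braid_word" where
  "run s L = map (\<lambda>b. (s - b, True)) [0..<L]"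

text \<open>The positive braid with \<open>L M\<close> crossings that exchanges a ribbon of \<open>M\<close> strands with a
  ribbon of \<open>L\<close> strands; \<open>\<sigma>\<^sub>s\<close>, at the place where the ribbons meet, comes first. Cabled
  generators are the case \<open>L = M\<close>; the other shapes occur in the proof of the braid relations.\<close>

definition grid :: "nat \<Rightarrow> nat \<Rightarrow> nat \<Rightarrow> braid_word" where
  "grid s L M = concat (map (\<lambda>a. run (s + a) M) [0..<L])"

lemma run_0 [simp]: "run s 0 = []"
  by (simp add: run_def)

lemma run_Suc: "run s (Suc L) = run s L @ [(s - L, True)]"
  by (simp add: run_def)

lemma run_add: "run s (L + M) = run s L @ run (s - L) M"
  by (induction M) (simp_all add: run_Suc)

lemma run_in_braid_words: "L \<le> s \<Longrightarrow> s < n \<Longrightarrow> run s L \<in> braid_words n"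
  by (auto simp: run_def braid_words_def)

lemma grid_0 [simp]: "grid s 0 M = []"
  by (simp add: grid_def)

lemma grid_Suc: "grid s (Suc L) M = grid s L M @ run (s + L) M"
  by (simp add: grid_def)

lemma set_run: "L \<le> s \<Longrightarrow> x \<in> set (run s L) \<Longrightarrow> snd x \<and> s < fst x + L \<and> fst x \<le> s"
  by (auto simp: run_def)

lemma set_grid: "M \<le> s \<Longrightarrow> x \<in> set (grid s L M) \<Longrightarrow> snd x \<and> s < fst x + M \<and> fst x < s + L"
  by (induction L) (auto simp: grid_Suc dest: set_run[rotated])

lemma grid_in_braid_words: "M \<le> s \<Longrightarrow> s + L \<le> n \<Longrightarrow> grid s L M \<in> braid_words n"
  by (induction L) (auto simp: grid_Suc run_in_braid_words)

lemma map_shift_grid: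
  "M \<le> s \<Longrightarrow> map (\<lambda>(k, e). (k + d, e)) (grid s L M) = grid (s + d) L M"
  by (induction L) (auto simp: grid_Suc run_def)

declare braid_eq.trans [trans]

lemma far_letters_commute:
  assumes "i \<in> {1..<n}" "j \<in> {1..<n}" "i + 2 \<le> j \<or> j + 2 \<le> i"
  shows "braid_eq n [(i, True), (j, True)] [(j, True), (i, True)]"
  using assms braid_eq.far braid_eq.sym by blast

lemma far_letter_word_commute:
  assumes "i \<in> {1..<n}" "w \<in> braid_words n"
    "\<forall>x\<in>set w. snd x \<and> (i + 2 \<le> fst x \<or> fst x + 2 \<le> i)"
  shows "braid_eq n ((i, True) # w) (w @ [(i, True)])"
  using assms(2,3)
proof (induction w)
  case Nil
  then show ?case using assms(1) by (auto intro: braid_eq.refl)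
next
  case (Cons x w)
  obtain j where x: "x = (j, True)" using Cons.prems by (cases x) auto
  have w: "w \<in> braid_words n" and j: "j \<in> {1..<n}" "i + 2 \<le> j \<or> j + 2 \<le> i"
    using Cons.prems x by auto
  have "braid_eq n ((i, True) # x # w) (x # (i, True) # w)"
    using braid_eq.append[OF _ w far_letters_commute[OF assms(1) j], of "[]"] by (simp add: x)
  also have "braid_eq n (x # (i, True) # w) (x # w @ [(i, True)])"
    using braid_eq.append[OF _ _ Cons.IH, of "[x]" "[]"] Cons.prems by simp
  finally show ?case by simp
qed

lemma far_words_commute:
  assumes "u \<in> braid_words n" "w \<in> braid_words n" "\<forall>x\<in>set u. snd x"
    "\<forall>x\<in>set w. snd x" "\<forall>x\<in>set u. \<forall>y\<in>set w. fst x + 2 \<le> fst y \<or> fst y + 2 \<le> fst x"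
  shows "braid_eq n (u @ w) (w @ u)"
  using assms(1,3,5)
proof (induction u)
  case Nil
  then show ?case using assms(2) by (auto intro: braid_eq.refl)
next
  case (Cons x u)
  obtain i where x: "x = (i, True)" using Cons.prems by (cases x) auto
  have u: "u \<in> braid_words n" and i: "i \<in> {1..<n}" using Cons.prems x by auto
  have "braid_eq n (x # u @ w) (x # w @ u)"
    using braid_eq.append[OF _ _ Cons.IH, of "[x]" "[]"] Cons.prems by simp
  also have "braid_eq n (x # w @ u) (w @ x # u)"
    using braid_eq.append[OF _ u far_letter_word_commute[OF i assms(2)], of "[]"]
      Cons.prems assms(4) by (auto simp: x)
  finally show ?case by simp
qed

section \<open>Braid relations for the cabled generators\<close>

text \<open>The letters of the run other than \<open>k\<close> and \<open>k + 1\<close> are far from \<open>k + 1\<close> if they are to the right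
  of these two, and far from \<open>k\<close> if they are to the left, so this reduces to
  \<open>\<sigma>\<^bsub>k+1\<^esub> \<sigma>\<^sub>k \<sigma>\<^bsub>k+1\<^esub> = \<sigma>\<^sub>k \<sigma>\<^bsub>k+1\<^esub> \<sigma>\<^sub>k\<close>.\<close>

lemma run_shift:
  assumes "L \<le> s" "s < n" "s < k + L" "k < s"
  shows "braid_eq n (run s L @ [(Suc k, True)]) ((k, True) # run s L)"
proof -
  (* M letters precede k + 1 in the run, and N letters follow k. *)
  define M where "M = s - Suc k"
  define N where "N = L - (M + 2)"
  let ?u = "run s M" and ?v = "run (k - 1) N"
  have s: "s = Suc k + M" and L: "L = Suc (Suc M) + N" using assms by (auto simp: M_def N_def)
  have k: "k \<ge> 1" "N \<le> k - 1" using assms L s by linarith+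
  have run: "run s L = ?u @ [(Suc k, True), (k, True)] @ ?v"
    unfolding L run_add run_Suc s by simp
  have u: "?u \<in> braid_words n" and v: "?v \<in> braid_words n"
    using assms k s by (auto intro!: run_in_braid_words)
  have kn: "k \<in> {1..<n}" "Suc k \<in> {1..<n}" using k assms by auto
  have "braid_eq n (?v @ [(Suc k, True)]) ([(Suc k, True)] @ ?v)"
  proof (rule far_words_commute[OF v])
    show "\<forall>x\<in>set ?v. \<forall>y\<in>set [(Suc k, True)]. fst x + 2 \<le> fst y \<or> fst y + 2 \<le> fst x"
      using set_run[OF k(2)] k(1) by fastforce
  qed (use kn set_run[OF k(2)] in auto)
  then have "braid_eq n (run s L @ [(Suc k, True)])
      ((?u @ [(Suc k, True), (k, True)]) @ ([(Suc k, True)] @ ?v) @ [])"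
    unfolding run using u kn braid_eq.append[of "?u @ [(Suc k, True), (k, True)]" n "[]"] by fastforce
  also have "braid_eq n \<dots> (?u @ [(k, True), (Suc k, True), (k, True)] @ ?v)"
    using braid_eq.append[OF u v braid_eq.sym[OF braid_eq.braid[OF kn]]] by simp
  also have "braid_eq n \<dots> ((k, True) # run s L)"
  proof -
    have "braid_eq n (?u @ [(k, True)]) ([(k, True)] @ ?u)"
    proof (rule far_words_commute[OF u])
      show "\<forall>x\<in>set ?u. \<forall>y\<in>set [(k, True)]. fst x + 2 \<le> fst y \<or> fst y + 2 \<le> fst x"
        using set_run[of M s] s by fastforce
    qed (use kn set_run[of M s] s in auto)
    from braid_eq.append[OF _ _ this, of "[]" "[(Suc k, True), (k, True)] @ ?v"]
    show ?thesis using v kn by (simp add: run)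
  qed
  finally show ?thesis .
qed

text \<open>Each of the \<open>L\<close> runs lowers the letter by one (\<open>run_shift\<close>). A crossing inside the
  ribbon of \<open>M\<close> strands is thereby carried along with this ribbon.\<close>

lemma grid_shift_letter:
  assumes "M \<le> s" "s + L \<le> n" "s < k + M" "k < s"
  shows "braid_eq n (grid s L M @ [(k + L, True)]) ((k, True) # grid s L M)"
  using assms(2)
proof (induction L)
  case 0
  then show ?case using assms by (auto intro!: braid_eq.refl)
next
  case (Suc L)
  have g: "grid s L M \<in> braid_words n" and r: "run (s + L) M \<in> braid_words n"
    using assms Suc.prems by (auto intro!: run_in_braid_words grid_in_braid_words)
  have "braid_eq n (run (s + L) M @ [(Suc (k + L), True)]) ((k + L, True) # run (s + L) M)"
    using assms Suc.prems by (intro run_shift) auto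
  from braid_eq.append[OF g _ this, of "[]"]
  have "braid_eq n (grid s (Suc L) M @ [(k + Suc L, True)])
      (grid s L M @ (k + L, True) # run (s + L) M)"
    by (simp add: grid_Suc)
  also have "braid_eq n \<dots> ((k, True) # grid s (Suc L) M)"
    using braid_eq.append[OF _ r Suc.IH, of "[]"] Suc.prems by (simp add: grid_Suc)
  finally show ?case .
qed

lemma grid_shift_word:
  assumes "M \<le> s" "s + L \<le> n"
    "\<forall>x\<in>set w. snd x \<and> s < fst x + M \<and> fst x < s"
  shows "braid_eq n (grid s L M @ map (\<lambda>(k, e). (k + L, e)) w) (w @ grid s L M)"
  using assms(3)
proof (induction w)
  case Nil
  then show ?case using assms by (auto intro!: braid_eq.refl grid_in_braid_words)
next
  case (Cons x w)
  obtain k where x: "x = (k, True)" using Cons.prems by (cases x) auto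
  have k: "s < k + M" "k < s" using Cons.prems x by auto
  let ?w = "map (\<lambda>(k, e). (k + L, e)) w"
  have w: "?w \<in> braid_words n"
    using Cons.prems assms by (fastforce simp: braid_words_def)
  have "braid_eq n (grid s L M @ map (\<lambda>(k, e). (k + L, e)) (x # w)) (x # grid s L M @ ?w)"
    using braid_eq.append[OF _ w grid_shift_letter[OF assms(1,2) k], of "[]"] by (simp add: x)
  also have "braid_eq n \<dots> (x # w @ grid s L M)"
    using braid_eq.append[OF _ _ Cons.IH, of "[x]" "[]"] Cons.prems k assms by (simp add: x)
  finally show ?case by simp
qed

text \<open>A ribbon of \<open>L\<close> strands that crosses \<open>M\<close> strands and then \<open>N\<close> more crosses \<open>M + N\<close> strands. On words, the
  \<open>a\<close>-th run of the second grid continues the \<open>a\<close>-th run of the first one, and the runs can be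
  interleaved because the runs that have to change places are far from each other.\<close>

lemma grid_merge:
  assumes "N \<le> s" "s + M + L \<le> n"
  shows "braid_eq n (grid (s + M) L M @ grid s L N) (grid (s + M) L (M + N))"
  using assms(2)
proof (induction L)
  case 0
  then show ?case by (auto intro!: braid_eq.refl)
next
  case (Suc L)
  let ?a = "grid (s + M) L M" and ?b = "grid s L N"
  let ?u = "run (s + M + L) M" and ?v = "run (s + L) N"
  have w: "?a \<in> braid_words n" "?b \<in> braid_words n" "?u \<in> braid_words n" "?v \<in> braid_words n"
    using assms(1) Suc.prems by (auto intro!: run_in_braid_words grid_in_braid_words)
  have "braid_eq n (?u @ ?b) (?b @ ?u)"
  proof (rule far_words_commute)
    show "\<forall>x\<in>set ?u. \<forall>y\<in>set ?b. fst x + 2 \<le> fst y \<or> fst y + 2 \<le> fst x"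
      using set_run[of M "s + M + L"] set_grid[OF assms(1)] by fastforce
  qed (use w set_run[of M "s + M + L"] set_grid[OF assms(1)] in auto)
  from braid_eq.append[OF w(1,4) this]
  have "braid_eq n (grid (s + M) (Suc L) M @ grid s (Suc L) N) ((?a @ ?b) @ ?u @ ?v)"
    by (simp add: grid_Suc)
  also have "braid_eq n \<dots> (grid (s + M) (Suc L) (M + N))"
    using braid_eq.append[OF _ _ Suc.IH, of "[]" "?u @ ?v"] w Suc.prems
    by (simp add: grid_Suc run_add)
  finally show ?case .
qed

text \<open>Write \<open>c\<close> and \<open>d\<close> for two consecutive cabled generators. By \<open>grid_merge\<close>, the product \<open>d c\<close> is a
  single grid with runs of length \<open>2 r\<close>. The letters of \<open>c\<close> are exactly those to which
  \<open>grid_shift_word\<close> applies, so \<open>(d c) d = c (d c)\<close>.\<close>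

lemma grid_braid:
  assumes "r \<le> s" "s + 2 * r \<le> n"
  shows "braid_eq n (grid s r r @ grid (s + r) r r @ grid s r r)
    (grid (s + r) r r @ grid s r r @ grid (s + r) r r)"
proof -
  let ?c = "grid s r r" and ?d = "grid (s + r) r r" and ?e = "grid (s + r) r (r + r)"
  have w: "?c \<in> braid_words n" "?d \<in> braid_words n"
    using assms by (auto intro!: grid_in_braid_words)
  have de: "braid_eq n (?d @ ?c) ?e" using assms by (intro grid_merge) auto
  have "braid_eq n (?e @ map (\<lambda>(k, e). (k + r, e)) ?c) (?c @ ?e)"
    using assms by (intro grid_shift_word) (auto dest: set_grid[rotated])
  then have ed: "braid_eq n (?e @ ?d) (?c @ ?e)"
    by (simp only: map_shift_grid[OF assms(1)])
  have "braid_eq n (?c @ ?d @ ?c) (?c @ ?e)"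
    using braid_eq.append[OF w(1) _ de, of "[]"] by simp
  also have "braid_eq n \<dots> (?e @ ?d)" by (rule braid_eq.sym[OF ed])
  also have "braid_eq n \<dots> (?d @ ?c @ ?d)"
    using braid_eq.append[OF _ w(2) braid_eq.sym[OF de], of "[]"] by simp
  finally show ?thesis .
qed

lemma cabling_word_eq_grid:
  "[(r * i + a - b, True). a \<leftarrow> [0..<r], b \<leftarrow> [0..<r]] = grid (r * i) r r"
  by (simp add: grid_def run_def)

lemma cabled_word_in_braid_words:
  assumes "i \<in> {1..<n}"
  shows "grid (r * i) r r \<in> braid_words (n * r)"
proof (rule grid_in_braid_words)
  have "r * Suc i \<le> r * n" using assms by (intro mult_le_mono2) auto
  then show "r * i + r \<le> n * r" by (simp add: algebra_simps)
  show "r \<le> r * i" using assms by simp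
qed

lemma braid_relations_cabling:
  "braid_relations (braid_group (n * r)) n (\<lambda>i. braid_class (n * r) (grid (r * i) r r))"
  unfolding braid_relations_def
proof (intro conjI ballI allI impI)
  fix i assume "i \<in> {1..<n}"
  then show "braid_class (n * r) (grid (r * i) r r) \<in> carrier (braid_group (n * r))"
    using cabled_word_in_braid_words by (auto simp: braid_group_carrier)
next
  fix i j assume ij: "i \<in> {1..<n}" "j \<in> {1..<n}" "i + 2 \<le> j"
  have le: "r \<le> r * i" "r \<le> r * j" "r * i + 2 * r \<le> r * j"
    using ij mult_le_mono2[OF ij(3), of r] by (auto simp: algebra_simps)
  have "braid_eq (n * r) (grid (r * i) r r @ grid (r * j) r r) (grid (r * j) r r @ grid (r * i) r r)"
  proof (rule far_words_commute)
    show "\<forall>x\<in>set (grid (r * i) r r). \<forall>y\<in>set (grid (r * j) r r).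
        fst x + 2 \<le> fst y \<or> fst y + 2 \<le> fst x"
      using set_grid[OF le(1)] set_grid[OF le(2)] le(3) by fastforce
  qed (use ij cabled_word_in_braid_words set_grid[OF le(1)] set_grid[OF le(2)] in auto)
  then show "braid_class (n * r) (grid (r * i) r r) \<otimes>\<^bsub>braid_group (n * r)\<^esub>
      braid_class (n * r) (grid (r * j) r r) =
    braid_class (n * r) (grid (r * j) r r) \<otimes>\<^bsub>braid_group (n * r)\<^esub>
      braid_class (n * r) (grid (r * i) r r)"
    using ij cabled_word_in_braid_words by (simp add: braid_group_mult braid_class_eq)
next
  fix i assume i: "i \<in> {1..<n} \<and> Suc i \<in> {1..<n}"
  have "r * (i + 2) \<le> r * n" using i by (intro mult_le_mono2) auto
  then have "braid_eq (n * r) (grid (r * i) r r @ grid (r * i + r) r r @ grid (r * i) r r)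
    (grid (r * i + r) r r @ grid (r * i) r r @ grid (r * i + r) r r)"
    using i by (intro grid_braid) (auto simp: algebra_simps)
  then show "braid_class (n * r) (grid (r * i) r r) \<otimes>\<^bsub>braid_group (n * r)\<^esub>
      braid_class (n * r) (grid (r * Suc i) r r) \<otimes>\<^bsub>braid_group (n * r)\<^esub>
      braid_class (n * r) (grid (r * i) r r) =
    braid_class (n * r) (grid (r * Suc i) r r) \<otimes>\<^bsub>braid_group (n * r)\<^esub>
      braid_class (n * r) (grid (r * i) r r) \<otimes>\<^bsub>braid_group (n * r)\<^esub>
      braid_class (n * r) (grid (r * Suc i) r r)"
    using i cabled_word_in_braid_words[of i n r] cabled_word_in_braid_words[of "Suc i" n r]
    by (simp add: braid_group_mult braid_class_eq add.commute)
qed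

lemma cabling_hom: "cabling n r \<in> hom (braid_group n) (braid_group (n * r))"
  unfolding cabling_def cabling_word_eq_grid
  by (rule braid_lift_hom[OF group_braid_group braid_relations_cabling])

lemma cabling_sigma:
  "i \<in> {1..<n} \<Longrightarrow> cabling n r (sigma n i) = braid_class (n * r) (grid (r * i) r r)"
  unfolding cabling_def cabling_word_eq_grid
  by (rule braid_lift_sigma[OF group_braid_group braid_relations_cabling])

section \<open>Representations given on the generators\<close>

text \<open>The elements \<open>g\<close> with \<open>P R(g) = S(g) P\<close> are closed under products and inverses.\<close>

lemma intertwine_from_generators:
  assumes "group H" and R: "R \<in> hom (braid_group n) H" and S: "S \<in> hom (braid_group n) H"
    and P: "P \<in> carrier H"
    and gen: "\<And>i. i \<in> {1..<n} \<Longrightarrow> P \<otimes>\<^bsub>H\<^esub> R (sigma n i) = S (sigma n i) \<otimes>\<^bsub>H\<^esub> P"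
    and g: "g \<in> carrier (braid_group n)"
  shows "P \<otimes>\<^bsub>H\<^esub> R g = S g \<otimes>\<^bsub>H\<^esub> P"
proof -
  interpret H: group H by fact
  interpret R: group_hom "braid_group n" H R
    by (simp add: group_hom_def group_hom_axioms_def group_braid_group assms(1) R)
  interpret S: group_hom "braid_group n" H S
    by (simp add: group_hom_def group_hom_axioms_def group_braid_group assms(1) S)
  have letter: "braid_class n [(i, e)] \<in> carrier (braid_group n)"
    "P \<otimes>\<^bsub>H\<^esub> R (braid_class n [(i, e)]) = S (braid_class n [(i, e)]) \<otimes>\<^bsub>H\<^esub> P"
    if i: "i \<in> {1..<n}" for i e
  proof -
    have c: "braid_class n [(i, e)] \<in> carrier (braid_group n)" for e
      using i by (auto simp: braid_group_carrier)
    then show "braid_class n [(i, e)] \<in> carrier (braid_group n)" .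
    have s: "sigma n i \<in> carrier (braid_group n)" using c by (simp add: sigma_def)
    have inv: "braid_class n [(i, False)] = inv\<^bsub>braid_group n\<^esub> sigma n i"
    proof (rule R.inv_equality[symmetric])
      show "braid_class n [(i, False)] \<otimes>\<^bsub>braid_group n\<^esub> sigma n i = \<one>\<^bsub>braid_group n\<^esub>"
        using i braid_eq.cancel[OF i, of False]
        by (simp add: sigma_def braid_group_mult braid_group_one braid_class_eq)
    qed (use c s in auto)
    show "P \<otimes>\<^bsub>H\<^esub> R (braid_class n [(i, e)]) = S (braid_class n [(i, e)]) \<otimes>\<^bsub>H\<^esub> P"
    proof (cases e)
      case True
      then show ?thesis using gen[OF i] by (simp add: sigma_def)
    next
      case False
      let ?x = "R (sigma n i)" and ?y = "S (sigma n i)"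
      have xy: "?x \<in> carrier H" "?y \<in> carrier H" using s by auto
      have "P \<otimes>\<^bsub>H\<^esub> inv\<^bsub>H\<^esub> ?x = inv\<^bsub>H\<^esub> ?y \<otimes>\<^bsub>H\<^esub> (?y \<otimes>\<^bsub>H\<^esub> P) \<otimes>\<^bsub>H\<^esub> inv\<^bsub>H\<^esub> ?x"
        using P xy by (simp add: H.m_assoc[symmetric])
      also have "\<dots> = inv\<^bsub>H\<^esub> ?y \<otimes>\<^bsub>H\<^esub> P"
        using P xy by (simp add: gen[OF i, symmetric] H.m_assoc)
      finally show ?thesis using False s by (simp add: inv)
    qed
  qed
  obtain w where "w \<in> braid_words n" "g = braid_class n w"
    using g by (auto simp: braid_group_carrier)
  then show ?thesis
  proof (induction w arbitrary: g)
    case Nil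
    then show ?case using P by (simp add: braid_group_one[symmetric])
  next
    case (Cons x w)
    obtain i e where x: "x = (i, e)" by force
    have i: "i \<in> {1..<n}" and w: "w \<in> braid_words n" using Cons.prems x by auto
    let ?a = "braid_class n [(i, e)]" and ?b = "braid_class n w"
    have b: "?b \<in> carrier (braid_group n)" using w by (auto simp: braid_group_carrier)
    note a = letter[OF i, of e]
    have g: "g = ?a \<otimes>\<^bsub>braid_group n\<^esub> ?b" using Cons.prems i w x by (simp add: braid_group_mult)
    have "P \<otimes>\<^bsub>H\<^esub> R g = (P \<otimes>\<^bsub>H\<^esub> R ?a) \<otimes>\<^bsub>H\<^esub> R ?b"
      using P a(1) b by (simp add: g H.m_assoc)
    also have "\<dots> = S ?a \<otimes>\<^bsub>H\<^esub> (P \<otimes>\<^bsub>H\<^esub> R ?b)"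
      using P a(1) b by (simp add: a(2) H.m_assoc)
    also have "\<dots> = S g \<otimes>\<^bsub>H\<^esub> P"
      using P a(1) b by (simp add: Cons.IH[OF w HOL.refl] g H.m_assoc)
    finally show ?case .
  qed
qed

lemma GL_carrier_mat: "A \<in> carrier (GL N) \<Longrightarrow> A \<in> carrier_mat N N"
  by (simp add: carrier_GL)

lemma four_block_diag_mult:
  fixes A B C D :: "'a::field mat"
  assumes "A \<in> carrier_mat m m" "B \<in> carrier_mat m m" "C \<in> carrier_mat k k" "D \<in> carrier_mat k k"
  shows "four_block_mat A (0\<^sub>m m k) (0\<^sub>m k m) C * four_block_mat B (0\<^sub>m m k) (0\<^sub>m k m) D =
    four_block_mat (A * B) (0\<^sub>m m k) (0\<^sub>m k m) (C * D)"
  using assms by (subst mult_four_block_mat[of _ m m _ k _ k _ _ m _ k]) auto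

lemma four_block_diag_GL:
  fixes A D :: "'a::field mat"
  assumes A: "A \<in> carrier (GL m)" and D: "D \<in> carrier (GL k)"
  shows "four_block_mat A (0\<^sub>m m k) (0\<^sub>m k m) D \<in> carrier (GL (m + k))"
proof -
  obtain A' where A': "A' \<in> carrier_mat m m" "A * A' = 1\<^sub>m m" "A' * A = 1\<^sub>m m"
    using A by (auto simp: carrier_GL)
  obtain D' where D': "D' \<in> carrier_mat k k" "D * D' = 1\<^sub>m k" "D' * D = 1\<^sub>m k"
    using D by (auto simp: carrier_GL)
  have one: "four_block_mat (1\<^sub>m m) (0\<^sub>m m k) (0\<^sub>m k m) (1\<^sub>m k) = (1\<^sub>m (m + k) :: 'a mat)"
    by (rule eq_matI) auto
  show ?thesis
    unfolding carrier_GL using GL_carrier_mat[OF A] GL_carrier_mat[OF D] A' D'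
    by (intro conjI bexI[of _ "four_block_mat A' (0\<^sub>m m k) (0\<^sub>m k m) D'"])
      (simp_all add: four_block_diag_mult one)
qed

lemma diag_block_mat_square_blocks:
  assumes "\<And>B. B \<in> set As \<Longrightarrow> B \<in> carrier_mat n n"
  shows "diag_block_mat As \<in> carrier_mat (length As * n) (length As * n)"
proof -
  have "sum_list (map dim_row As) = length As * n" "sum_list (map dim_col As) = length As * n"
    using assms by (induction As) auto
  then show ?thesis by (auto simp: dim_diag_block_mat)
qed

lemma diag_block_mat_Cons_square_blocks:
  assumes "A \<in> carrier_mat n n" "\<And>B. B \<in> set As \<Longrightarrow> B \<in> carrier_mat n n"
  shows "diag_block_mat (A # As) =
    four_block_mat A (0\<^sub>m n (length As * n)) (0\<^sub>m (length As * n) n) (diag_block_mat As)"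
  using assms(1) diag_block_mat_square_blocks[of As n, OF assms(2)] by (auto simp: Let_def)

text \<open>The induction step is the case of two summands, where the product and the inverse of
  block-diagonal matrices are taken block by block.\<close>

lemma rep_direct_sum_hom:
  fixes Rs :: "('g \<Rightarrow> 'a::field mat) list"
  assumes "group G" and "\<And>R. R \<in> set Rs \<Longrightarrow> R \<in> hom G (GL n)"
  shows "rep_direct_sum Rs \<in> hom G (GL (length Rs * n))"
  using assms(2)
proof (induction Rs)
  case Nil
  show ?case
    by (rule homI) (auto simp: rep_direct_sum_def carrier_GL intro!: eq_matI)
next
  case (Cons R Rs)
  have R: "R \<in> hom G (GL n)" and S: "rep_direct_sum Rs \<in> hom G (GL (length Rs * n))"
    using Cons by auto
  have sum: "rep_direct_sum (R # Rs) g = four_block_mat (R g) (0\<^sub>m n (length Rs * n))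
      (0\<^sub>m (length Rs * n) n) (rep_direct_sum Rs g)" if "g \<in> carrier G" for g
  proof -
    have "T g \<in> carrier_mat n n" if "T \<in> set (R # Rs)" for T
      using Cons.prems[OF that] \<open>g \<in> carrier G\<close> by (auto simp: hom_def intro: GL_carrier_mat)
    then show ?thesis
      using diag_block_mat_Cons_square_blocks[of "R g" n "map (\<lambda>R. R g) Rs"]
      by (auto simp: rep_direct_sum_def)
  qed
  have closed: "R g \<in> carrier (GL n)" "rep_direct_sum Rs g \<in> carrier (GL (length Rs * n))"
    if "g \<in> carrier G" for g using R S that by (auto simp: hom_def)
  show ?case
  proof (rule homI)
    fix x y assume xy: "x \<in> carrier G" "y \<in> carrier G"
    show "rep_direct_sum (R # Rs) x \<in> carrier (GL (length (R # Rs) * n))"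
      using four_block_diag_GL[OF closed[OF xy(1)]] by (simp add: sum[OF xy(1)])
    show "rep_direct_sum (R # Rs) (x \<otimes>\<^bsub>G\<^esub> y) =
        rep_direct_sum (R # Rs) x \<otimes>\<^bsub>GL (length (R # Rs) * n)\<^esub> rep_direct_sum (R # Rs) y"
    proof -
      have xy': "x \<otimes>\<^bsub>G\<^esub> y \<in> carrier G"
        using xy assms(1) by (simp add: group.is_monoid monoid.m_closed)
      have "R (x \<otimes>\<^bsub>G\<^esub> y) = R x * R y"
        "rep_direct_sum Rs (x \<otimes>\<^bsub>G\<^esub> y) = rep_direct_sum Rs x * rep_direct_sum Rs y"
        using R S xy by (simp_all add: hom_def)
      then show ?thesis
        using closed[OF xy(1)] closed[OF xy(2)]
        by (simp add: sum[OF xy'] sum[OF xy(1)] sum[OF xy(2)] four_block_diag_mult GL_carrier_mat)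
    qed
  qed
qed

lemma diag_block_mat_mult_vec:
  fixes As :: "'a::field mat list"
  assumes "\<And>A. A \<in> set As \<Longrightarrow> A \<in> carrier_mat n n" "v \<in> carrier_vec (length As * n)"
    "t < length As" "k < n"
  shows "(diag_block_mat As *\<^sub>v v) $ (t * n + k) = (As ! t *\<^sub>v vec n (\<lambda>l. v $ (t * n + l))) $ k"
  using assms
proof (induction As arbitrary: v t)
  case Nil
  then show ?case by simp
next
  case (Cons A As)
  have A: "A \<in> carrier_mat n n" and As: "\<And>B. B \<in> set As \<Longrightarrow> B \<in> carrier_mat n n"
    using Cons.prems by auto
  have D: "diag_block_mat As \<in> carrier_mat (length As * n) (length As * n)"
    "diag_block_mat (A # As) =
      four_block_mat A (0\<^sub>m n (length As * n)) (0\<^sub>m (length As * n) n) (diag_block_mat As)"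
    using diag_block_mat_square_blocks[of As n] diag_block_mat_Cons_square_blocks[OF A] As by blast+
  define a where "a = vec n (\<lambda>l. v $ l)"
  define d where "d = vec (length As * n) (\<lambda>l. v $ (n + l))"
  have ad: "a \<in> carrier_vec n" "d \<in> carrier_vec (length As * n)" by (auto simp: a_def d_def)
  have v: "v = a @\<^sub>v d"
    using Cons.prems(2) by (intro eq_vecI) (auto simp: a_def d_def)
  have Dv: "diag_block_mat (A # As) *\<^sub>v v = (A *\<^sub>v a) @\<^sub>v (diag_block_mat As *\<^sub>v d)"
    unfolding D(2) v by (rule mult_mat_vec_split[OF A D(1) ad])
  show ?case
  proof (cases t)
    case 0
    then show ?thesis using Dv A D(1) Cons.prems(4) by (simp add: a_def del: diag_block_mat.simps)
  next
    case (Suc u)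
    have lt: "u * n + k < length As * n"
    proof -
      have "Suc u * n \<le> length As * n" using Cons.prems(3) Suc by (intro mult_le_mono1) auto
      then show ?thesis using Cons.prems(4) by simp
    qed
    have "(diag_block_mat (A # As) *\<^sub>v v) $ (t * n + k) = (diag_block_mat As *\<^sub>v d) $ (u * n + k)"
      unfolding Dv using A D(1) lt by (simp add: Suc ad)
    also have "\<dots> = (As ! u *\<^sub>v vec n (\<lambda>l. d $ (u * n + l))) $ k"
      using Cons.prems(3,4) Suc As ad by (intro Cons.IH) auto
    also have "vec n (\<lambda>l. d $ (u * n + l)) = vec n (\<lambda>l. v $ (t * n + l))"
    proof (rule eq_vecI)
      fix l assume "l < dim_vec (vec n (\<lambda>l. v $ (t * n + l)))"
      moreover have "Suc u * n \<le> length As * n" using Cons.prems(3) Suc by (intro mult_le_mono1) auto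
      ultimately show "vec n (\<lambda>l. d $ (u * n + l)) $ l = vec n (\<lambda>l. v $ (t * n + l)) $ l"
        by (simp add: d_def Suc add.assoc)
    qed simp
    finally show ?thesis by (simp add: Suc)
  qed
qed

text \<open>\<open>rep_scale\<close> depends only on the matrices of the generators. Once the scaled matrices are
  known to be of this local form, the braid relations reduce to invertibility and one equation between \<open>a\<close>, \<open>b\<close>, \<open>c\<close>
  and \<open>e\<close>.\<close>

lemma rep_scale_hom_sigma:
  assumes "\<And>i. i \<in> {1..<n} \<Longrightarrow> s \<cdot>\<^sub>m R (sigma n i) = local_mat n i e (mat2 a b c 0)"
    and "e \<noteq> 0" "b * c \<noteq> 0" "a * a * e + a * b * c = a * e * e"
  shows "rep_scale n n s R \<in> hom (braid_group n) (GL n)"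
    and "i \<in> {1..<n} \<Longrightarrow> rep_scale n n s R (sigma n i) = local_mat n i e (mat2 a b c 0)"
proof -
  have rel: "braid_relations (GL n) n (\<lambda>i. s \<cdot>\<^sub>m R (sigma n i))"
    using braid_relations_local_mat[OF assms(2-4), of n] unfolding braid_relations_def
    by (auto simp: assms(1))
  show "rep_scale n n s R \<in> hom (braid_group n) (GL n)"
    unfolding rep_scale_def by (rule braid_lift_hom[OF group_GL rel])
  assume i: "i \<in> {1..<n}"
  show "rep_scale n n s R (sigma n i) = local_mat n i e (mat2 a b c 0)"
    unfolding rep_scale_def using braid_lift_sigma[OF group_GL rel i] assms(1)[OF i] by simp
qed

lemma smult_map_local_mat:
  assumes i: "i \<in> {1..<m}" and h: "h 0 = 0"
  shows "s \<cdot>\<^sub>m map_mat h (local_mat m i e (mat2 a b c d)) =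
    local_mat m i (s * h e) (mat2 (s * h a) (s * h b) (s * h c) (s * h d))"
  by (rule eq_matI)
    (use i h local_mat_carrier2[OF i, of e a b c d]
      local_mat_carrier2[OF i, of "s * h e" "s * h a" "s * h b" "s * h c" "s * h d"]
      in \<open>auto simp: local_mat_index\<close>)

lemma fract_subst_inverse_diff:
  assumes t: "transcendental t" and nz: "t \<noteq> 0"
  shows "fract_subst t 0 = 0" "fract_subst t 1 = 1" "fract_subst t (inverse qq) = inverse t"
    "fract_subst t (x - y) = fract_subst t x - fract_subst t y"
proof -
  note h = fract_subst_hom[OF t]
  show "fract_subst t 0 = 0" "fract_subst t 1 = 1" using h(1)[of 0] h(1)[of 1] by simp_all
  then have "fract_subst t (inverse qq) * t = 1"
    using h(4)[of "inverse qq" qq] by (simp add: h(2))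
  then show "fract_subst t (inverse qq) = inverse t" using nz by (metis inverse_unique mult.commute)
  show "fract_subst t (x - y) = fract_subst t x - fract_subst t y"
    using h(3)[of "x - y" y] by (simp add: algebra_simps)
qed

lemma scaled_burau_qpow:
  fixes s :: "'k::field poly fract" and n :: nat
  assumes m: "m \<noteq> 0" and s: "s \<noteq> 0"
  defines "t \<equiv> qq powi m :: 'k poly fract"
  defines "T \<equiv> rep_scale n n s (rep_qpow m (burau_rep n))"
  shows "T \<in> hom (braid_group n) (GL n)"
    and "i \<in> {1..<n} \<Longrightarrow> T (sigma n i) =
      local_mat n i (s * t) (mat2 (s * (t - inverse t)) (s * t) (s * inverse t) 0)"
proof -
  have nz: "t \<noteq> 0" by (simp add: t_def)
  have tr: "transcendental t" unfolding t_def by (rule transcendental_qq_powi[OF m])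
  have gen: "s \<cdot>\<^sub>m rep_qpow m (burau_rep n) (sigma n i) =
      local_mat n i (s * t) (mat2 (s * (t - inverse t)) (s * t) (s * inverse t) 0)"
    if i: "i \<in> {1..<n}" for i
    using i fract_subst_inverse_diff[OF tr nz] fract_subst_hom(2)[OF tr]
    by (simp add: rep_qpow_def burau_rep(2) burau_mat_def smult_map_local_mat flip: t_def)
  have "s * (t - inverse t) * (s * (t - inverse t)) * (s * t) + s * (t - inverse t) * (s * t) * (s * inverse t)
      = s * (t - inverse t) * (s * t) * (s * t)"
    using nz by (simp add: field_simps)
  note * = rep_scale_hom_sigma[OF gen _ _ this]
  show "T \<in> hom (braid_group n) (GL n)" unfolding T_def by (rule *(1)) (use nz s in auto)
  show "i \<in> {1..<n} \<Longrightarrow> T (sigma n i) =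
      local_mat n i (s * t) (mat2 (s * (t - inverse t)) (s * t) (s * inverse t) 0)"
    unfolding T_def by (rule *(2)) (use nz s in auto)
qed

lemma scaled_sym_qpow:
  fixes s :: "'k::field poly fract" and n :: nat
  assumes m: "m \<noteq> 0" and s: "s \<noteq> 0"
  defines "t \<equiv> qq powi m :: 'k poly fract"
  defines "T \<equiv> rep_scale n n s (rep_qpow m (sym_rep n))"
  shows "T \<in> hom (braid_group n) (GL n)"
    and "i \<in> {1..<n} \<Longrightarrow> T (sigma n i) = local_mat n i s (mat2 0 (s * t) (s * t) 0)"
proof -
  have nz: "t \<noteq> 0" by (simp add: t_def)
  have tr: "transcendental t" unfolding t_def by (rule transcendental_qq_powi[OF m])
  have gen: "s \<cdot>\<^sub>m rep_qpow m (sym_rep n) (sigma n i) = local_mat n i s (mat2 0 (s * t) (s * t) 0)"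
    if i: "i \<in> {1..<n}" for i
    using i fract_subst_inverse_diff[OF tr nz] fract_subst_hom(2)[OF tr]
    by (simp add: rep_qpow_def sym_rep(2) sym_mat_def smult_map_local_mat flip: t_def)
  note * = rep_scale_hom_sigma[OF gen]
  show "T \<in> hom (braid_group n) (GL n)" unfolding T_def by (rule *(1)) (use nz s in auto)
  show "i \<in> {1..<n} \<Longrightarrow> T (sigma n i) = local_mat n i s (mat2 0 (s * t) (s * t) 0)"
    unfolding T_def by (rule *(2)) (use nz s in auto)
qed

section \<open>The Burau matrix of a cabled generator\<close>

lemma burau_word_append:
  fixes v :: "'k::field poly fract vec"
  assumes "u \<in> braid_words m" "w \<in> braid_words m" "v \<in> carrier_vec m"
  shows "eval_word (GL m) (burau_mat m) (u @ w) *\<^sub>v v =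
    eval_word (GL m) (burau_mat m) u *\<^sub>v (eval_word (GL m) (burau_mat m) w *\<^sub>v v)"
proof -
  have c: "\<forall>i\<in>{1..<m}. burau_mat m i \<in> carrier (GL m :: 'k poly fract mat monoid)"
    using braid_relations_burau unfolding braid_relations_def by blast
  have w: "eval_word (GL m) (burau_mat m) w' \<in> (carrier_mat m m :: 'k poly fract mat set)" if "w' \<in> braid_words m" for w'
    using eval_word_closed[OF group_GL c that] by (rule GL_carrier_mat)
  then show "eval_word (GL m) (burau_mat m) (u @ w) *\<^sub>v v =
    eval_word (GL m) (burau_mat m) u *\<^sub>v (eval_word (GL m) (burau_mat m) w *\<^sub>v v)"
    using assms by (simp add: eval_word_append[OF group_GL c assms(1,2)] assoc_mult_mat_vec[of _ m m _ m])
qed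

lemma burau_letter:
  fixes v :: "'k::field poly fract vec"
  assumes "i \<in> {1..<m}" "v \<in> carrier_vec m"
  shows "eval_word (GL m) (burau_mat m) [(i, True)] *\<^sub>v v =
    vec m (\<lambda>j. if j = i - 1 then (qq - inverse qq) * v $ (i - 1) + qq * v $ i
               else if j = i then inverse qq * v $ (i - 1) else qq * v $ j)"
proof -
  have "(burau_mat m i :: 'k poly fract mat) \<in> carrier_mat m m"
    unfolding burau_mat_def using assms(1) by (rule local_mat_carrier2)
  then have "eval_word (GL m) (burau_mat m) [(i, True)] = (burau_mat m i :: 'k poly fract mat)"
    by simp
  then show ?thesis
    unfolding burau_mat_def using assms by (auto simp: local_mat_mult_vec intro!: eq_vecI)
qed

text \<open>The strand that crosses the others carries the entry \<open>v $ (s - L)\<close> upwards to the position \<open>s\<close>.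
  It loses a factor \<open>q\<close> at each crossing and leaves behind the multiple \<open>q - q\<^sup>-\<^sup>1\<close> of its
  current value, which is then multiplied by \<open>q\<close> at each of the later crossings. Every
  entry that is passed moves down by one. Induction on \<open>L\<close> appends the letter that acts first.\<close>

lemma burau_run:
  fixes v :: "'k::field poly fract vec"
  assumes "L \<le> s" "s < m" "v \<in> carrier_vec m"
  shows "eval_word (GL m) (burau_mat m) (run s L) *\<^sub>v v =
    vec m (\<lambda>x. if x + L < s \<or> s < x then qq ^ L * v $ x
      else if x = s then inverse qq ^ L * v $ (s - L)
      else (qq - inverse qq) * qq ^ (L - 1) * inverse qq ^ (2 * (x - (s - L))) * v $ (s - L)
        + qq ^ L * v $ Suc x)"
  using assms(1,3)
proof (induction L arbitrary: v)
  case 0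
  then show ?case by (auto intro!: eq_vecI)
next
  case (Suc L)
  let ?i = "s - L"
  have i: "?i \<in> {1..<m}" using Suc.prems assms(2) by auto
  have w: "run s L \<in> braid_words m" "[(?i, True)] \<in> braid_words m"
    using i Suc.prems assms(2) by (auto intro!: run_in_braid_words)
  define u where "u = eval_word (GL m) (burau_mat m) [(?i, True)] *\<^sub>v v"
  note u = burau_letter[OF i Suc.prems(2), folded u_def]
  have uc: "u \<in> carrier_vec m" by (simp add: u)
  have 1: "eval_word (GL m) (burau_mat m) (run s (Suc L)) *\<^sub>v v =
      eval_word (GL m) (burau_mat m) (run s L) *\<^sub>v u"
    unfolding run_Suc u_def by (rule burau_word_append[OF w Suc.prems(2)])
  have IH: "eval_word (GL m) (burau_mat m) (run s L) *\<^sub>v u = vec m (\<lambda>x. if x + L < s \<or> s < x then qq ^ L * u $ x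
      else if x = s then inverse qq ^ L * u $ (s - L)
      else (qq - inverse qq) * qq ^ (L - 1) * inverse qq ^ (2 * (x - (s - L))) * u $ (s - L)
        + qq ^ L * u $ Suc x)"
    using Suc.prems uc by (intro Suc.IH) auto
  show ?case unfolding 1 IH
  proof (rule eq_vecI, goal_cases)
    case (1 x)
    then have x: "x < m" by simp
    have i1: "s - Suc L = s - L - 1" "s - L \<ge> 1" using Suc.prems by auto
    consider "x + L + 1 < s" | "x + L + 1 = s" | "s \<le> x + L" "x < s" | "x = s" | "s < x" by linarith
    then show ?case
    proof cases
      case 3
      obtain d where d: "x = s - L + d" using 3 by (metis le_diff_conv le_Suc_ex)
      have "L \<ge> 1" using 3 by auto
      then obtain L' where L': "L = Suc L'" by (cases L) auto
      have d2: "x - (s - L) = d" "x - (s - Suc L) = Suc d" using d i1 by auto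
      have uv: "u $ (s - L) = inverse qq * v $ (s - Suc L)" "u $ Suc x = qq * v $ Suc x"
      proof -
        have "s - L \<noteq> s - L - 1" "Suc x \<noteq> s - L - 1" "Suc x \<noteq> s - L" "s - L < m" "Suc x < m"
          using 3 i1 assms(2) by linarith+
        then show "u $ (s - L) = inverse qq * v $ (s - Suc L)" "u $ Suc x = qq * v $ Suc x"
          unfolding u i1(1) by simp_all
      qed
      have "qq ^ L' * inverse qq = (qq ^ L * inverse qq ^ 2 :: 'k poly fract)"
        by (simp add: L' power2_eq_square)
      moreover have "L - 1 = L'" by (simp add: L')
      ultimately have "qq ^ (L - 1) * u $ (s - L) = qq ^ L * inverse qq ^ 2 * v $ (s - Suc L)"
        unfolding uv by (simp only: mult.assoc[symmetric])
      then have "(qq - inverse qq) * inverse qq ^ (2 * d) * (qq ^ (L - 1) * u $ (s - L)) =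
          (qq - inverse qq) * inverse qq ^ (2 * d) * (qq ^ L * inverse qq ^ 2 * v $ (s - Suc L))"
        by (simp only:)
      then have "(qq - inverse qq) * qq ^ (L - 1) * inverse qq ^ (2 * d) * u $ (s - L) =
          (qq - inverse qq) * qq ^ L * inverse qq ^ (2 * Suc d) * v $ (s - Suc L)"
        unfolding mult_Suc_right power_add by (simp only: mult_ac)
      moreover have "qq ^ L * u $ Suc x = qq ^ Suc L * v $ Suc x"
        unfolding uv by (simp add: mult_ac)
      ultimately show ?thesis using 3 x d2 by simp
    qed (use x assms(2) Suc.prems i1 in \<open>auto simp: u algebra_simps\<close>)
  qed simp
qed

text \<open>The run that acts first carries away the top entry of the lower ribbon. Every later run starts
  below the entries left behind so far and moves them down by one with the factor \<open>q\<^sup>r\<close>. After all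
  runs, each of the \<open>L\<close> entries carried away has therefore left its traces at the same \<open>r\<close> positions
  with the same coefficients, which is why only the sum of these entries occurs.\<close>

lemma burau_grid:
  fixes v :: "'k::field poly fract vec"
  assumes "r \<le> s" "s + L \<le> m" "v \<in> carrier_vec m"
  shows "eval_word (GL m) (burau_mat m) (grid s L r) *\<^sub>v v =
    vec m (\<lambda>x. if x + r < s \<or> s + L \<le> x then qq ^ (r * L) * v $ x
      else if x < s then qq ^ (r * L) * v $ (x + L)
        + (qq - inverse qq) * qq ^ (r - 1) * inverse qq ^ (2 * (x - (s - r))) * qq ^ (r * (L - 1))
          * (\<Sum>a<L. v $ (s - r + a))
      else qq ^ (r * (L - 1)) * inverse qq ^ r * v $ (x - r))"
  using assms(2,3)
proof (induction L arbitrary: v)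
  case 0
  then show ?case by (auto intro!: eq_vecI)
next
  case (Suc L)
  have w: "grid s L r \<in> braid_words m" "run (s + L) r \<in> braid_words m"
    using assms(1) Suc.prems by (auto intro!: run_in_braid_words grid_in_braid_words)
  define u where "u = eval_word (GL m) (burau_mat m) (run (s + L) r) *\<^sub>v v"
  have "r \<le> s + L" "s + L < m" using assms(1) Suc.prems by auto
  note u = burau_run[OF this Suc.prems(2), folded u_def]
  have uc: "u \<in> carrier_vec m" by (simp add: u)
  have 1: "eval_word (GL m) (burau_mat m) (grid s (Suc L) r) *\<^sub>v v =
      eval_word (GL m) (burau_mat m) (grid s L r) *\<^sub>v u"
    unfolding grid_Suc u_def by (rule burau_word_append[OF w Suc.prems(2)])
  have IH: "eval_word (GL m) (burau_mat m) (grid s L r) *\<^sub>v u =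
    vec m (\<lambda>x. if x + r < s \<or> s + L \<le> x then qq ^ (r * L) * u $ x
      else if x < s then qq ^ (r * L) * u $ (x + L)
        + (qq - inverse qq) * qq ^ (r - 1) * inverse qq ^ (2 * (x - (s - r))) * qq ^ (r * (L - 1))
          * (\<Sum>a<L. u $ (s - r + a))
      else qq ^ (r * (L - 1)) * inverse qq ^ r * u $ (x - r))"
    using Suc.prems uc by (intro Suc.IH) auto
  have low: "u $ x = qq ^ r * v $ x" if "x + r < s + L" for x
    using that Suc.prems by (simp add: u)
  have sum: "(\<Sum>a<L. u $ (s - r + a)) = qq ^ r * (\<Sum>a<L. v $ (s - r + a))"
    unfolding sum_distrib_left using assms(1) by (intro sum.cong) (auto intro!: low)
  have pow: "qq ^ (r * (L - 1)) * (qq ^ r * y) = qq ^ (r * L) * y" if "L > 0" for y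
    using that by (cases L) (simp_all add: power_add)
  show ?case unfolding 1 IH
  proof (rule eq_vecI, goal_cases)
    case (1 x)
    then have x: "x < m" by simp
    consider "x + r < s \<or> s + L < x" | "s \<le> x + r" "x < s" | "s \<le> x" "x < s + L" | "s \<le> x" "x = s + L"
      by linarith
    then show ?case
    proof cases
      case 1
      then show ?thesis using x Suc.prems assms(1) by (auto simp: u power_add)
    next
      case 2
      have y: "x + L < m" "x + L - (s + L - r) = x - (s - r)" using 2 Suc.prems assms(1) by auto
      define D :: "'k poly fract"
        where "D = (qq - inverse qq) * qq ^ (r - 1) * inverse qq ^ (2 * (x - (s - r)))"
      have ux: "u $ (x + L) = D * v $ (s - r + L) + qq ^ r * v $ Suc (x + L)"
        using 2 y assms(1) by (simp add: u D_def)
      have us: "qq ^ (r * (L - 1)) * (\<Sum>a<L. u $ (s - r + a)) = qq ^ (r * L) * (\<Sum>a<L. v $ (s - r + a))"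
        unfolding sum using pow by (cases "L > 0") (blast, simp)
      have "qq ^ (r * L) * u $ (x + L) + D * (qq ^ (r * (L - 1)) * (\<Sum>a<L. u $ (s - r + a))) =
          qq ^ (r * Suc L) * v $ (x + Suc L) + D * qq ^ (r * L) * (\<Sum>a<Suc L. v $ (s - r + a))"
        unfolding ux us by (simp add: algebra_simps power_add)
      then show ?thesis using 2 x by (simp add: D_def mult.assoc)
    next
      case 3
      then show ?thesis using x assms(1) pow[of "inverse qq ^ r * v $ (x - r)"]
        by (simp add: low algebra_simps)
    next
      case 4
      then show ?thesis using x assms(1) by (simp add: u)
    qed
  qed simp
qed

text \<open>The coefficients are those of \<open>burau_grid\<close> with \<open>L = r\<close>. Blocks, like the entries of vectors, are
  numbered from 0, so that \<open>\<sigma>\<^sub>i\<close> exchanges the blocks \<open>i - 1\<close> and \<open>i\<close>.\<close>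

lemma burau_cabling_sigma:
  fixes v :: "'k::field poly fract vec"
  assumes i: "i \<in> {1..<n}" and v: "v \<in> carrier_vec (n * r)" and kj: "k < n" "j < r"
  shows "(burau_rep (n * r) (cabling n r (sigma n i)) *\<^sub>v v) $ (k * r + j) =
    (if k = i - 1 then qq ^ r\<^sup>2 * v $ (i * r + j)
        + (qq - inverse qq) * qq ^ (r - 1) * inverse qq ^ (2 * j) * qq ^ (r * (r - 1))
          * (\<Sum>a<r. v $ ((i - 1) * r + a))
     else if k = i then qq ^ (r * (r - 1)) * inverse qq ^ r * v $ ((i - 1) * r + j)
     else qq ^ r\<^sup>2 * v $ (k * r + j))"
proof -
  have w: "grid (r * i) r r \<in> braid_words (n * r)" by (rule cabled_word_in_braid_words[OF i])
  have E: "burau_rep (n * r) (cabling n r (sigma n i)) = eval_word (GL (n * r)) (burau_mat (n * r)) (grid (r * i) r r)"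
    unfolding cabling_sigma[OF i] burau_rep_def by (rule braid_lift_class[OF group_GL braid_relations_burau w])
  obtain i' where i': "i = Suc i'" using i by (cases i) auto
  have le: "Suc i * r \<le> n * r" "Suc k * r \<le> n * r" using i kj by (simp_all only: mult_le_mono1 Suc_leI atLeastLessThan_iff)
  have G: "r \<le> r * i" "r * i + r \<le> n * r" using i le by (auto simp: algebra_simps)
  have x: "k * r + j < n * r" using le kj by simp
  consider "k < i'" | "k = i'" | "k = i" | "i < k" using i' by linarith
  then show ?thesis
  proof cases
    case 1
    have "Suc k * r \<le> i' * r" using 1 by (intro mult_le_mono1) auto
    then show ?thesis using 1 x kj i' unfolding E burau_grid[OF G v]
      by (simp add: power2_eq_square algebra_simps)
  next
    case 2
    then show ?thesis using x kj i' unfolding E burau_grid[OF G v]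
      by (simp add: power2_eq_square algebra_simps)
  next
    case 3
    then show ?thesis using x kj i' unfolding E burau_grid[OF G v]
      by (simp add: power2_eq_square algebra_simps)
  next
    case 4
    have "Suc i * r \<le> k * r" using 4 by (intro mult_le_mono1) auto
    then show ?thesis using 4 x kj i' unfolding E burau_grid[OF G v]
      by (simp add: power2_eq_square algebra_simps)
  qed
qed

section \<open>The intertwining matrix\<close>

text \<open>The columns are indexed by \<open>k r + j\<close> (entry \<open>j\<close> of the block \<open>k\<close>) and the rows by
  \<open>t n + k\<close> (coordinate \<open>k\<close> of the summand \<open>t\<close>). Restricted to the block \<open>k\<close>, the row \<open>t n + k\<close> is the sum of
  the entries for \<open>t = 0\<close>, and otherwise the functional \<open>q\<^bsup>rk\<^esup> (v\<^sub>t - q\<^bsup>-2t\<^esup> v\<^sub>0)\<close>, which vanishes on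
  the vector of the \<open>q\<^bsup>-2j\<^esup>\<close>. The factor \<open>q\<^bsup>rk\<^esup>\<close> makes the two coefficients of an exchange of
  blocks equal.\<close>

definition basis_change :: "nat \<Rightarrow> nat \<Rightarrow> 'k::field poly fract mat" where
  "basis_change n r = mat (n * r) (n * r) (\<lambda>(x, y).
     let t = x div n; k = x mod n; j = y mod r in
     if y div r \<noteq> k then 0
     else if t = 0 then 1
     else qq ^ (r * k) * ((if j = t then 1 else 0) - (if j = 0 then inverse qq ^ (2 * t) else 0)))"

lemma sum_blocks:
  fixes f :: "nat \<Rightarrow> 'a::comm_monoid_add"
  shows "(\<Sum>y<n * r. f y) = (\<Sum>k<n. \<Sum>j<r. f (k * r + j))"
proof -
  have "sum f {k * r..<k * r + r} = (\<Sum>j<r. f (k * r + j))" for k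
    by (rule sum.reindex_bij_witness[of _ "\<lambda>j. k * r + j" "\<lambda>y. y - k * r"]) auto
  then show ?thesis using sum.nat_group[of f r n] by simp
qed

lemma basis_change_mult_vec:
  fixes v :: "'k::field poly fract vec"
  assumes v: "v \<in> carrier_vec (n * r)" and tk: "t < r" "k < n"
  shows "(basis_change n r *\<^sub>v v) $ (t * n + k) =
    (if t = 0 then \<Sum>j<r. v $ (k * r + j)
     else qq ^ (r * k) * (v $ (k * r + t) - inverse qq ^ (2 * t) * v $ (k * r)))"
proof -
  have "Suc t * n \<le> r * n" using tk by (intro mult_le_mono1) auto
  then have x: "t * n + k < n * r" using tk by (simp add: algebra_simps)
  define c where "c j = (if t = 0 then 1 else qq ^ (r * k) * ((if j = t then 1 else 0) -
      (if j = 0 then inverse qq ^ (2 * t) else 0)) :: 'k poly fract)" for j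
  have "(basis_change n r *\<^sub>v v) $ (t * n + k) =
      (\<Sum>y<n * r. (if y div r = k then c (y mod r) else 0) * v $ y)"
    using x v tk by (auto simp: basis_change_def scalar_prod_def atLeast0LessThan c_def Let_def
        simp del: power_inverse intro!: sum.cong)
  also have "\<dots> = (\<Sum>l<n. \<Sum>j<r. (if l = k then c j else 0) * v $ (l * r + j))"
    unfolding sum_blocks by (intro sum.cong) auto
  also have "\<dots> = (\<Sum>l<n. if l = k then \<Sum>j<r. c j * v $ (l * r + j) else 0)"
    by (intro sum.cong) auto
  also have "\<dots> = (\<Sum>j<r. c j * v $ (k * r + j))" using tk by simp
  also have "\<dots> = (if t = 0 then \<Sum>j<r. v $ (k * r + j)
     else qq ^ (r * k) * (v $ (k * r + t) - inverse qq ^ (2 * t) * v $ (k * r)))"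
  proof (cases "t = 0")
    case False
    have "(\<Sum>j<r. c j * v $ (k * r + j)) =
      qq ^ (r * k) * ((\<Sum>j<r. if j = t then v $ (k * r + j) else 0)
        - (\<Sum>j<r. if j = 0 then inverse qq ^ (2 * t) * v $ (k * r + j) else 0))"
      unfolding sum_subtractf[symmetric] sum_distrib_left using False
      by (intro sum.cong) (auto simp: c_def algebra_simps)
    then show ?thesis using False tk by simp
  qed (simp add: c_def)
  finally show ?thesis .
qed

lemma qq_power_neq_1:
  assumes "m > 0"
  shows "qq ^ m \<noteq> (1 :: 'k::field poly fract)"
proof
  assume "qq ^ m = (1 :: 'k poly fract)"
  moreover have "fract_const (- 1) + fract_const 1 = (0 :: 'k poly fract)"
    unfolding fract_const_simps(3)[symmetric] by simp
  ultimately have "eval_at (qq ^ m) [:- 1, 1:] = (0 :: 'k poly fract)" by simp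
  moreover have "transcendental (qq ^ m :: 'k poly fract)" by (rule transcendental_qq_power[OF assms])
  ultimately have "[:- 1, 1:] = (0 :: 'k poly)" unfolding transcendental_def by blast
  then show False by simp
qed

text \<open>Here the sum is \<open>s(D)\<close>, for the vector \<open>D\<close> of the \<open>q\<^bsup>-2j\<^esup>\<close> and the sum \<open>s\<close> of the entries. The first
  formula yields the diagonal coefficient of the Burau matrix at \<open>q\<^sup>r\<close>; the second is the condition for the decomposition of a block to be direct.\<close>

lemma geometric_inverse_qq:
  fixes q :: "'k::field poly fract"
  defines "q \<equiv> qq"
  shows "r \<ge> 1 \<Longrightarrow> (q - inverse q) * q ^ (r - 1) * (\<Sum>j<r. inverse q ^ (2 * j)) = q ^ r - inverse q ^ r"
    and "r \<ge> 1 \<Longrightarrow> (\<Sum>j<r. inverse q ^ (2 * j)) \<noteq> 0"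
proof -
  have q: "q \<noteq> 0" by (simp add: q_def)
  assume r: "r \<ge> 1"
  have "(q - inverse q) * q ^ (r - 1) = q ^ r * (1 - inverse q ^ 2)"
    using r q by (cases r) (simp_all add: field_simps power2_eq_square)
  then have "(q - inverse q) * q ^ (r - 1) * (\<Sum>j<r. inverse q ^ (2 * j)) =
      q ^ r * ((1 - inverse q ^ 2) * (\<Sum>j<r. (inverse q ^ 2) ^ j))"
    by (simp only: power_mult mult.assoc)
  also have "\<dots> = q ^ r * (1 - (inverse q ^ 2) ^ r)"
    by (simp only: one_diff_power_eq)
  also have "\<dots> = q ^ r - inverse q ^ r"
  proof -
    have "(inverse q ^ 2) ^ r = inverse q ^ r * inverse q ^ r"
      by (simp only: power_mult[symmetric] power_add[symmetric] mult_2)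
    moreover have "q ^ r * inverse q ^ r = 1" using q by (simp add: power_mult_distrib[symmetric])
    ultimately show ?thesis by (simp add: algebra_simps)
  qed
  finally show 1: "(q - inverse q) * q ^ (r - 1) * (\<Sum>j<r. inverse q ^ (2 * j)) = q ^ r - inverse q ^ r" .
  show "(\<Sum>j<r. inverse q ^ (2 * j)) \<noteq> 0"
  proof
    assume "(\<Sum>j<r. inverse q ^ (2 * j)) = 0"
    then have "q ^ r = inverse q ^ r" using 1 by simp
    then have "q ^ r * q ^ r = 1" using q by (metis power_mult_distrib right_inverse power_one)
    then have "q ^ (r + r) = 1" by (simp add: power_add)
    then show False using qq_power_neq_1[of "r + r", where ?'k = 'k] r by (simp add: q_def)
  qed
qed

text \<open>In a vector of the kernel, each block is a multiple of the vector \<open>D\<close> of the \<open>q\<^bsup>-2j\<^esup>\<close>, by the rows with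
  \<open>t > 0\<close>. By the row with \<open>t = 0\<close>, the multiple is zero, because the sum of the entries of \<open>D\<close> is not.\<close>

lemma basis_change_GL:
  assumes "r \<ge> 1"
  shows "(basis_change n r :: 'k::field poly fract mat) \<in> carrier (GL (n * r))"
proof -
  let ?P = "basis_change n r :: 'k poly fract mat"
  have P: "?P \<in> carrier_mat (n * r) (n * r)" by (simp add: basis_change_def)
  have "v = 0\<^sub>v (n * r)" if v: "v \<in> carrier_vec (n * r)" "?P *\<^sub>v v = 0\<^sub>v (n * r)" for v
  proof (rule eq_vecI)
    have P0: "(?P *\<^sub>v v) $ (t * n + k) = 0" if "t < r" "k < n" for t k
    proof -
      have "Suc t * n \<le> r * n" using that by (intro mult_le_mono1) auto
      then have "t * n + k < n * r" using that by (simp add: algebra_simps)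
      then show ?thesis using v(2) by simp
    qed
    have ratio: "v $ (k * r + j) = inverse qq ^ (2 * j) * v $ (k * r)" if "k < n" "j < r" for k j
      using P0[OF that(2,1)] that basis_change_mult_vec[OF v(1) that(2,1)] by (cases "j = 0") simp_all
    have zero: "v $ (k * r) = 0" if k: "k < n" for k
    proof -
      have r: "0 < r" using assms by simp
      have "(\<Sum>j<r. inverse qq ^ (2 * j)) * v $ (k * r) = (\<Sum>j<r. v $ (k * r + j))"
        unfolding sum_distrib_right by (intro sum.cong HOL.refl) (simp add: ratio k del: power_inverse)
      also have "\<dots> = 0"
        using P0[OF r k] basis_change_mult_vec[OF v(1) r k] by simp
      finally show ?thesis using geometric_inverse_qq(2)[OF assms] by (metis mult_eq_0_iff)
    qed
    fix x assume "x < dim_vec (0\<^sub>v (n * r) :: 'k poly fract vec)"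
    then have "x < n * r" by simp
    then have "x div r < n" "x mod r < r" using assms by (simp_all add: less_mult_imp_div_less)
    then show "v $ x = 0\<^sub>v (n * r) $ x"
      using ratio[of "x div r" "x mod r"] zero[of "x div r"] \<open>x < n * r\<close> by simp
  qed (use v in simp)
  then have "det ?P \<noteq> 0" using det_0_iff_vec_prod_zero_field[OF P] by blast
  then show ?thesis using det_non_zero_imp_unit[OF P] by (simp add: GL_def units_of_def)
qed

section \<open>The decomposition\<close>

text \<open>Both sides are evaluated on a vector, and the coordinates \<open>t n + k\<close> are compared. For
  \<open>t = 0\<close>, the sums over the blocks satisfy the Burau formula by \<open>geometric_inverse_qq\<close>. For
  \<open>t > 0\<close>, the functional does not see the entries left behind, and only the exchange of the blocks remains.\<close>

lemma basis_change_intertwines_sigma: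
  fixes T U :: "'k::field poly fract mat"
  assumes r: "r \<ge> 1" and i: "i \<in> {1..<n}"
  defines "p \<equiv> inverse qq :: 'k poly fract" and "s \<equiv> qq ^ (r * (r - 1)) :: 'k poly fract"
  assumes T: "T = local_mat n i (s * qq ^ r) (mat2 (s * (qq ^ r - p ^ r)) (s * qq ^ r) (s * p ^ r) 0)"
    and U: "U = local_mat n i (qq ^ r\<^sup>2) (mat2 0 (qq ^ r\<^sup>2 * p ^ r) (qq ^ r\<^sup>2 * p ^ r) 0)"
  shows "basis_change n r * burau_rep (n * r) (cabling n r (sigma n i)) =
    diag_block_mat (T # replicate (r - 1) U) * basis_change n r"
proof (rule mat_eq_by_vec[of _ "n * r"])
  let ?P = "basis_change n r :: 'k poly fract mat"
  let ?B = "burau_rep (n * r) (cabling n r (sigma n i)) :: 'k poly fract mat"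
  let ?Ts = "T # replicate (r - 1) U"
  let ?D = "diag_block_mat ?Ts"
  have len: "length ?Ts = r" using r by simp
  have T': "T \<in> carrier_mat n n" and U': "U \<in> carrier_mat n n"
    unfolding T U by (rule local_mat_carrier2[OF i])+
  have Ts: "A \<in> carrier_mat n n" if "A \<in> set ?Ts" for A
    using that T' U' by (auto split: if_splits)
  have P: "?P \<in> carrier_mat (n * r) (n * r)" by (simp add: basis_change_def)
  have D: "?D \<in> carrier_mat (n * r) (n * r)"
    using diag_block_mat_square_blocks[of ?Ts n, OF Ts] unfolding len by (simp only: mult.commute)
  have "sigma n i \<in> carrier (braid_group n)"
    using i by (auto simp: sigma_def braid_group_carrier)
  then have "cabling n r (sigma n i) \<in> carrier (braid_group (n * r))"
    using cabling_hom unfolding hom_def by blast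
  then have "?B \<in> carrier (GL (n * r))" using burau_rep(1) unfolding hom_def by blast
  then have B: "?B \<in> carrier_mat (n * r) (n * r)" by (rule GL_carrier_mat)
  show "?P * ?B \<in> carrier_mat (n * r) (n * r)" "?D * ?P \<in> carrier_mat (n * r) (n * r)"
    using P D B by auto
  fix v :: "'k poly fract vec" assume v: "v \<in> carrier_vec (n * r)"
  have "?P *\<^sub>v (?B *\<^sub>v v) = ?D *\<^sub>v (?P *\<^sub>v v)"
  proof (rule eq_vecI)
    fix x assume "x < dim_vec (?D *\<^sub>v (?P *\<^sub>v v))"
    then have "x < n * r" using D by simp
    moreover define t k where "t = x div n" and "k = x mod n"
    ultimately have tk: "t < r" "k < n" and x: "x = t * n + k"
      using i by (simp_all add: less_mult_imp_div_less mult.commute)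
    define w where "w = ?B *\<^sub>v v"
    have wc: "w \<in> carrier_vec (n * r)" unfolding w_def using B v by simp
    note w = burau_cabling_sigma[OF i v, folded w_def p_def s_def]
    define u where "u = vec n (\<lambda>l. (?P *\<^sub>v v) $ (t * n + l))"
    have uc: "u \<in> carrier_vec n" by (simp add: u_def)
    have u: "u $ l = (if t = 0 then \<Sum>j<r. v $ (l * r + j)
       else qq ^ (r * l) * (v $ (l * r + t) - p ^ (2 * t) * v $ (l * r)))" if "l < n" for l
      unfolding u_def p_def using basis_change_mult_vec[OF v tk(1) that] that by simp
    have lhs: "(?P *\<^sub>v w) $ x = (if t = 0 then \<Sum>j<r. w $ (k * r + j)
       else qq ^ (r * k) * (w $ (k * r + t) - p ^ (2 * t) * w $ (k * r + 0)))"
      unfolding x p_def using basis_change_mult_vec[OF wc tk] by simp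
    have rhs: "(?D *\<^sub>v (?P *\<^sub>v v)) $ x = (?Ts ! t *\<^sub>v u) $ k"
      unfolding x u_def
      by (rule diag_block_mat_mult_vec[OF Ts _ _ tk(2)])
        (use P v tk r in \<open>simp_all add: mult.commute[of r]\<close>)
    have qp: "qq ^ r * p ^ r = 1" by (simp add: p_def power_mult_distrib[symmetric])
    have s: "qq ^ r\<^sup>2 = s * qq ^ r"
      using r unfolding s_def by (cases r) (simp_all add: power2_eq_square power_add[symmetric] add.commute)
    show "(?P *\<^sub>v (?B *\<^sub>v v)) $ x = (?D *\<^sub>v (?P *\<^sub>v v)) $ x"
      unfolding w_def[symmetric] lhs rhs
    proof (cases "t = 0")
      case True
      have Tu: "(?Ts ! t *\<^sub>v u) $ k = (if k = i - 1 then s * (qq ^ r - p ^ r) * u $ (i - 1) + s * qq ^ r * u $ i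
          else if k = i then s * p ^ r * u $ (i - 1) else s * qq ^ r * u $ k)"
        using True tk by (simp add: T local_mat_mult_vec[OF i uc])
      have "(\<Sum>j<r. w $ (k * r + j)) = (?Ts ! t *\<^sub>v u) $ k"
      proof -
        define total where "total = (\<Sum>a<r. v $ ((i - 1) * r + a))"
        have u0: "u $ l = (\<Sum>j<r. v $ (l * r + j))" if "l < n" for l
          using u[OF that] True by simp
        consider "k = i - 1" | "k = i" "k \<noteq> i - 1" | "k \<noteq> i - 1" "k \<noteq> i" by blast
        then show ?thesis
        proof cases
          case 1
          have "(\<Sum>j<r. w $ (k * r + j)) = (\<Sum>j<r. qq ^ r\<^sup>2 * v $ (i * r + j)
              + (qq - p) * qq ^ (r - 1) * p ^ (2 * j) * s * total)"
            using 1 tk by (intro sum.cong HOL.refl) (simp add: w total_def)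
          also have "\<dots> = qq ^ r\<^sup>2 * (\<Sum>j<r. v $ (i * r + j))
              + (qq - p) * qq ^ (r - 1) * (\<Sum>j<r. p ^ (2 * j)) * (s * total)"
            by (simp add: sum.distrib sum_distrib_left sum_distrib_right mult_ac)
          also have "(qq - p) * qq ^ (r - 1) * (\<Sum>j<r. p ^ (2 * j)) = qq ^ r - p ^ r"
            unfolding p_def by (rule geometric_inverse_qq(1)[OF r])
          finally have "(\<Sum>j<r. w $ (k * r + j)) = s * qq ^ r * u $ i + (qq ^ r - p ^ r) * (s * u $ (i - 1))"
            using 1 tk i by (simp only: u0 total_def s atLeastLessThan_iff)
          then show ?thesis unfolding Tu using 1 by (simp add: algebra_simps)
        next
          case 2
          have "(\<Sum>j<r. w $ (k * r + j)) = (\<Sum>j<r. s * p ^ r * v $ ((i - 1) * r + j))"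
            using 2 tk by (intro sum.cong HOL.refl) (simp add: w)
          then show ?thesis unfolding Tu using 2 tk i by (simp add: u0 sum_distrib_left)
        next
          case 3
          have "(\<Sum>j<r. w $ (k * r + j)) = (\<Sum>j<r. s * qq ^ r * v $ (k * r + j))"
            using 3 tk by (intro sum.cong HOL.refl) (simp add: w s)
          then show ?thesis unfolding Tu using 3 tk by (simp add: u0 sum_distrib_left)
        qed
      qed
      then show "(if t = 0 then \<Sum>j<r. w $ (k * r + j)
         else qq ^ (r * k) * (w $ (k * r + t) - p ^ (2 * t) * w $ (k * r + 0))) = (?Ts ! t *\<^sub>v u) $ k"
        using True by simp
    next
      case False
      have Uu: "(?Ts ! t *\<^sub>v u) $ k = (if k = i - 1 then qq ^ r\<^sup>2 * p ^ r * u $ i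
          else if k = i then qq ^ r\<^sup>2 * p ^ r * u $ (i - 1) else qq ^ r\<^sup>2 * u $ k)"
        using False tk by (simp add: U local_mat_mult_vec[OF i uc])
      define f where "f l = v $ (l * r + t) - p ^ (2 * t) * v $ (l * r + 0)" for l
      have u1: "u $ l = qq ^ (r * l) * f l" if "l < n" for l
        using u[OF that] False by (simp add: f_def)
      (* The ratio of the scaling factors of two neighbouring blocks. *)
      have shift: "qq ^ (r * i) = (qq ^ (r * (i - 1)) * qq ^ r :: 'k poly fract)"
        using i by (cases i) (simp_all add: power_add)
      have "qq ^ (r * k) * (w $ (k * r + t) - p ^ (2 * t) * w $ (k * r + 0)) = (?Ts ! t *\<^sub>v u) $ k"
      proof -
        note wt = w[OF tk(2,1)] and w0 = w[OF tk(2), of 0]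
        have r0: "0 < r" using r by simp
        consider "k = i - 1" | "k = i" "k \<noteq> i - 1" | "k \<noteq> i - 1" "k \<noteq> i" by blast
        then show ?thesis
        proof cases
          case 1
          have "w $ (k * r + t) - p ^ (2 * t) * w $ (k * r + 0) = qq ^ r\<^sup>2 * f i"
            unfolding wt w0[OF r0] f_def using 1 by (simp add: algebra_simps)
          moreover have "qq ^ r\<^sup>2 * p ^ r * u $ i = (qq ^ r * p ^ r) * (qq ^ (r * (i - 1)) * (qq ^ r\<^sup>2 * f i))"
          proof -
            have "i < n" using i by simp
            from u1[OF this] show ?thesis unfolding shift by (simp only: mult_ac)
          qed
          ultimately show ?thesis unfolding Uu using 1 by (simp add: qp)
        next
          case 2
          have "w $ (k * r + t) - p ^ (2 * t) * w $ (k * r + 0) = s * p ^ r * f (i - 1)"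
            unfolding wt w0[OF r0] f_def using 2 by (simp add: algebra_simps)
          moreover have "qq ^ r\<^sup>2 * p ^ r * u $ (i - 1) = qq ^ (r * k) * (s * p ^ r * f (i - 1))"
          proof -
            have "i - 1 < n" using i by auto
            from u1[OF this] show ?thesis unfolding 2(1) shift s by (simp only: mult_ac)
          qed
          ultimately show ?thesis
            unfolding Uu by (simp only: if_P[OF 2(1)] if_not_P[OF 2(2)])
        next
          case 3
          have "w $ (k * r + t) - p ^ (2 * t) * w $ (k * r + 0) = qq ^ r\<^sup>2 * f k"
            unfolding wt w0[OF r0] f_def using 3 by (simp add: algebra_simps)
          then show ?thesis unfolding Uu using 3 tk by (simp add: u1 mult_ac)
        qed
      qed
      then show "(if t = 0 then \<Sum>j<r. w $ (k * r + j)
         else qq ^ (r * k) * (w $ (k * r + t) - p ^ (2 * t) * w $ (k * r + 0))) = (?Ts ! t *\<^sub>v u) $ k"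
        using False by simp
    qed
  qed (use P D B in simp)
  then show "?P * ?B *\<^sub>v v = ?D * ?P *\<^sub>v v"
    using P B D v by (simp add: assoc_mult_mat_vec[of _ "n * r" "n * r" _ "n * r"])
qed

theorem theorem2:
  fixes n r :: nat
  assumes "n \<ge> 2" and "r \<ge> 1"
  shows "rep_isomorphic (braid_group n) (n * r)
    (burau_rep (n * r) \<circ> cabling n r :: braid_word set \<Rightarrow> 'k::field_char_0 poly fract mat)
    (rep_direct_sum
      (rep_scale n n (qq ^ (r * (r - 1))) (rep_qpow (int r) (burau_rep n)) #
       replicate (r - 1) (rep_scale n n (qq ^ (r ^ 2)) (rep_qpow (- int r) (sym_rep n)))))"
proof -
  let ?R = "burau_rep (n * r) \<circ> cabling n r :: braid_word set \<Rightarrow> 'k poly fract mat"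
  define T :: "braid_word set \<Rightarrow> 'k poly fract mat"
    where "T = rep_scale n n (qq ^ (r * (r - 1))) (rep_qpow (int r) (burau_rep n))"
  define U :: "braid_word set \<Rightarrow> 'k poly fract mat"
    where "U = rep_scale n n (qq ^ r\<^sup>2) (rep_qpow (- int r) (sym_rep n))"
  let ?S = "rep_direct_sum (T # replicate (r - 1) U)"
  have m: "int r \<noteq> 0" "- int r \<noteq> 0" using assms(2) by auto
  have pow: "qq powi int r = (qq ^ r :: 'k poly fract)" "qq powi (- int r) = (inverse qq ^ r :: 'k poly fract)"
    by (simp_all add: power_int_minus power_inverse)
  have T: "T \<in> hom (braid_group n) (GL n)"
    unfolding T_def by (rule scaled_burau_qpow(1)[OF m(1)]) simp
  have U: "U \<in> hom (braid_group n) (GL n)"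
    unfolding U_def by (rule scaled_sym_qpow(1)[OF m(2)]) simp
  have R: "?R \<in> hom (braid_group n) (GL (n * r))"
    by (rule hom_compose[OF cabling_hom burau_rep(1)])
  have "?S \<in> hom (braid_group n) (GL (length (T # replicate (r - 1) U) * n))"
    by (rule rep_direct_sum_hom[OF group_braid_group]) (use T U in \<open>auto split: if_splits\<close>)
  moreover have "length (T # replicate (r - 1) U) * n = n * r" using assms(2) by simp
  ultimately have S: "?S \<in> hom (braid_group n) (GL (n * r))" by simp
  have "basis_change n r * ?R g = ?S g * basis_change n r" if g: "g \<in> carrier (braid_group n)" for g
  proof -
    have "basis_change n r \<otimes>\<^bsub>GL (n * r)\<^esub> ?R g = ?S g \<otimes>\<^bsub>GL (n * r)\<^esub> basis_change n r"
    proof (rule intertwine_from_generators[OF group_GL R S basis_change_GL[OF assms(2)] _ g])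
      fix i assume i: "i \<in> {1..<n}"
      have "T (sigma n i) = local_mat n i (qq ^ (r * (r - 1)) * qq ^ r)
          (mat2 (qq ^ (r * (r - 1)) * (qq ^ r - inverse qq ^ r)) (qq ^ (r * (r - 1)) * qq ^ r)
            (qq ^ (r * (r - 1)) * inverse qq ^ r) 0)"
        using scaled_burau_qpow(2)[OF m(1) _ i, of "qq ^ (r * (r - 1)) :: 'k poly fract"]
        by (simp add: T_def pow power_inverse)
      moreover have "U (sigma n i) = local_mat n i (qq ^ r\<^sup>2)
          (mat2 0 (qq ^ r\<^sup>2 * inverse qq ^ r) (qq ^ r\<^sup>2 * inverse qq ^ r) 0)"
        using scaled_sym_qpow(2)[OF m(2) _ i, of "qq ^ r\<^sup>2 :: 'k poly fract"]
        by (simp only: U_def pow) simp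
      ultimately have "basis_change n r * burau_rep (n * r) (cabling n r (sigma n i)) =
          diag_block_mat (T (sigma n i) # replicate (r - 1) (U (sigma n i))) * basis_change n r"
        by (rule basis_change_intertwines_sigma[OF assms(2) i])
      then show "basis_change n r \<otimes>\<^bsub>GL (n * r)\<^esub> ?R (sigma n i) =
          ?S (sigma n i) \<otimes>\<^bsub>GL (n * r)\<^esub> basis_change n r"
        by (simp add: rep_direct_sum_def del: diag_block_mat.simps)
    qed
    then show ?thesis by simp
  qed
  then show ?thesis
    unfolding rep_isomorphic_def T_def[symmetric] U_def[symmetric]
    using R S basis_change_GL[OF assms(2)] by blast
qed

end
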